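(* Let $H$ be a Hopf $*$-algebra over $\mathbb{C}$, let $V$ be a $*$-module over $H$, and endow the tensor algebra $T(V)$ with the unique $*$-algebra structure for which the inclusion $\iota_V:V\to T(V)$ is a $*$-module morphism, namely $(\overline{v_1\otimes\dots\otimes v_n})^*=\overline{v_n}^{\,*}\otimes\dots\otimes\overline{v_1}^{\,*}$. Let $A$ be a $*$-algebra in $\mathbf{HMod}$ and let $f:V\to A$ be a $*$-module map. Let $\tilde f:T(V)\to A$ be the unique morphism of module-algebras with $\tilde f\circ\iota_V=f$. Then $\tilde f$ is a morphism of $*$-algebras.
   Context: All vector spaces are over $\mathbb{C}$. A Hopf $*$-algebra is a Hopf algebra $H$ over $\mathbb{C}$ (coproduct $\Delta(a)=a_{(1)}\otimes a_{(2)}$, counit $\varepsilon$, antipode $S$) equipped with an antilinear map $*:H\to H$ such that $(a^* )^*=a$, $(ab)^*=b^*a^*$ and $\Delta(a^* )=a_{(1)}^*\otimes a_{(2)}^*$. $\mathbf{HMod}$ is the category of left $H$-modules and module maps; $\mathbb{C}$ is a module via $\varepsilon$ and tensor products are modules via $a\rhd(v\otimes w)=(a_{(1)}\rhd v)\otimes(a_{(2)}\rhd w)$. For a vector space $V$, the complex conjugate vector space $\overline{V}$ consists of formal symbols $\bar v$ ($v\in V$) with $\bar v+\bar w=\overline{v+w}$ and $\lambda\cdot\bar v=\overline{\bar\lambda v}$. For a linear map $T:V\to W$, $\overline T(\bar v)=\overline{T(v)}$. If $V$ is a left $H$-module, $\overline V$ is a left $H$-module via $a\rhd\bar v=\overline{S(a)^*\rhd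 v}$. Let $\sigma_V:\overline{\overline V}\to V$, $\bar{\bar v}\mapsto v$. A $*$-structure on an $H$-module $V$ is a module map $*:\overline V\to V$ with $*\circ\overline{*}=\sigma_V$; then $V$ is called a $*$-module, and $*(\bar v)$ is written $\bar v^{\,*}$. A linear map $T:V\to W$ of $*$-modules is a $*$-map if $T\circ *=*\circ\overline T$; a $*$-module map is a $*$-map that is also a module map. An algebra in $\mathbf{HMod}$ is a unital associative $\mathbb{C}$-algebra $A$ that is an $H$-module such that $a\rhd(xy)=(a_{(1)}\rhd x)(a_{(2)}\rhd y)$ and $a\rhd 1_A=\varepsilon(a)1_A$. A morphism of module-algebras is a module map that is also a (unital) algebra homomorphism. The conjugate $\overline A$ is an algebra in $\mathbf{HMod}$ with $\bar x\cdot\bar y=\overline{yx}$ and $1_{\overline A}=\overline{1_A}$. A $*$-algebra in $\mathbf{HMod}$ is an algebra $A$ in $\mathbf{HMod}$ with a $*$-structure $*:\overline A\to A$ that is also an algebra homomorphism. A morphism of $*$-algebras is an algebra homomorphism that is also a map of $*$-modules. $T(V)=\bigoplus_{n\ge0}V^{\otimes n}$, with $V^{\otimes0}=\mathbb{C}$, is an algebra in $\mathbf{HMod}$ with concatenation product. *)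

theory Defs
  imports Complex_Main "HOL-Library.Poly_Mapping"
begin

section \<open>Complex vector spaces and algebras\<close>

class scaleC =
  fixes scaleC :: "complex \<Rightarrow> 'a \<Rightarrow> 'a"  (infixr \<open>*\<^sub>C\<close> 75)

class complex_vector = scaleC + ab_group_add +
  assumes scaleC_add_right: "a *\<^sub>C (x + y) = a *\<^sub>C x + a *\<^sub>C y"
    and scaleC_add_left: "(a + b) *\<^sub>C x = a *\<^sub>C x + b *\<^sub>C x"
    and scaleC_scaleC [simp]: "a *\<^sub>C b *\<^sub>C x = (a * b) *\<^sub>C x"
    and scaleC_one [simp]: "1 *\<^sub>C x = x"

text \<open>
  Unital associative algebras.  The class \<^class>\<open>ring_1\<close> is avoided because it
  would exclude the zero algebra.
\<close>

class complex_algebra = complex_vector + ring + monoid_mult +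
  assumes mult_scaleC_left [simp]: "a *\<^sub>C x * y = a *\<^sub>C (x * y)"
    and mult_scaleC_right [simp]: "x * a *\<^sub>C y = a *\<^sub>C (x * y)"

global_interpretation complex_vector: vector_space "scaleC :: complex \<Rightarrow> 'a \<Rightarrow> 'a::complex_vector"
  by unfold_locales (simp_all add: scaleC_add_right scaleC_add_left)

abbreviation clinear :: "('a::complex_vector \<Rightarrow> 'b::complex_vector) \<Rightarrow> bool"
  where "clinear \<equiv> Vector_Spaces.linear scaleC scaleC"

lemma clinearI:
  assumes "\<And>x y. f (x + y) = f x + f y" and "\<And>c x. f (c *\<^sub>C x) = c *\<^sub>C f x"
  shows "clinear f"
  by unfold_locales (use assms in auto)

lemma clinearD:
  assumes "clinear f"
  shows "f (x + y) = f x + f y" "f (c *\<^sub>C x) = c *\<^sub>C f x" "f 0 = 0"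
    "f (x - y) = f x - f y"
proof -
  interpret Vector_Spaces.linear scaleC scaleC f by fact
  show "f (x + y) = f x + f y" "f (c *\<^sub>C x) = c *\<^sub>C f x" "f 0 = 0" "f (x - y) = f x - f y"
    by (simp_all add: add scale diff)
qed

definition cbilinear :: "('a::complex_vector \<Rightarrow> 'b::complex_vector \<Rightarrow> 'c::complex_vector) \<Rightarrow> bool"
  where "cbilinear B \<longleftrightarrow> (\<forall>y. clinear (\<lambda>x. B x y)) \<and> (\<forall>x. clinear (B x))"

lemma cbilinearI:
  assumes "\<And>x x' y. B (x + x') y = B x y + B x' y" "\<And>c x y. B (c *\<^sub>C x) y = c *\<^sub>C B x y"
    and "\<And>x y y'. B x (y + y') = B x y + B x y'" "\<And>c x y. B x (c *\<^sub>C y) = c *\<^sub>C B x y"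
  shows "cbilinear B"
  unfolding cbilinear_def by (intro conjI allI clinearI assms)

lemma cbilinearD:
  assumes "cbilinear B"
  shows "B (x + x') y = B x y + B x' y" "B (c *\<^sub>C x) y = c *\<^sub>C B x y"
    "B x (y + y') = B x y + B x y'" "B x (c *\<^sub>C y) = c *\<^sub>C B x y"
  using assms unfolding cbilinear_def by (auto dest: clinearD)

definition antilinear :: "('a::complex_vector \<Rightarrow> 'b::complex_vector) \<Rightarrow> bool"
  where "antilinear f \<longleftrightarrow> (\<forall>x y. f (x + y) = f x + f y) \<and> (\<forall>c x. f (c *\<^sub>C x) = cnj c *\<^sub>C f x)"

definition algebra_hom :: "('a::complex_algebra \<Rightarrow> 'b::complex_algebra) \<Rightarrow> bool"
  where "algebra_hom F \<longleftrightarrow> clinear F \<and> (\<forall>x y. F (x * y) = F x * F y) \<and> F 1 = 1"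

instantiation complex :: complex_algebra
begin

definition scaleC_complex :: "complex \<Rightarrow> complex \<Rightarrow> complex"
  where [simp]: "scaleC_complex c z = c * z"

instance by standard (simp_all add: algebra_simps)

end


section \<open>The complex conjugate of a vector space and of an algebra\<close>

datatype 'v conjugate = Bar (unbar: 'v)

instantiation conjugate :: (complex_vector) complex_vector
begin

definition "0 = Bar 0"
definition "x + y = Bar (unbar x + unbar y)"
definition "x - y = Bar (unbar x - unbar y)"
definition "- x = Bar (- unbar x)"
definition "c *\<^sub>C x = Bar (cnj c *\<^sub>C unbar x)"

instance
  by standard
    (simp_all add: zero_conjugate_def plus_conjugate_def minus_conjugate_def
      uminus_conjugate_def scaleC_conjugate_def scaleC_add_left scaleC_add_right algebra_simps)

end

instantiation conjugate :: (complex_algebra) complex_algebra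
begin

definition "1 = Bar 1"
definition "x * y = Bar (unbar y * unbar x)"

instance
  by standard
    (simp_all add: one_conjugate_def times_conjugate_def plus_conjugate_def
      scaleC_conjugate_def algebra_simps)

end

abbreviation conj_map :: "('v \<Rightarrow> 'w) \<Rightarrow> 'v conjugate \<Rightarrow> 'w conjugate"
  where "conj_map \<equiv> map_conjugate"

definition conj_sigma :: "'v conjugate conjugate \<Rightarrow> 'v"
  where "conj_sigma x = unbar (unbar x)"


section \<open>Free vector spaces\<close>

instantiation poly_mapping :: (type, complex_vector) complex_vector
begin

lift_definition scaleC_poly_mapping :: "complex \<Rightarrow> ('a \<Rightarrow>\<^sub>0 'b) \<Rightarrow> 'a \<Rightarrow>\<^sub>0 'b"
  is "\<lambda>c f k. c *\<^sub>C f k"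
  by (erule finite_subset[rotated]) auto

instance
  by standard (transfer, simp add: scaleC_add_left scaleC_add_right fun_eq_iff)+

end

lemma lookup_scaleC: "Poly_Mapping.lookup (c *\<^sub>C x) k = c *\<^sub>C Poly_Mapping.lookup x k"
  by transfer simp

lemma scaleC_single: "c *\<^sub>C Poly_Mapping.single k (1::complex) = Poly_Mapping.single k c"
  by (rule poly_mapping_eqI) (simp add: lookup_scaleC lookup_single when_def)

definition lin_ext :: "('k \<Rightarrow> 'b::complex_vector) \<Rightarrow> ('k \<Rightarrow>\<^sub>0 complex) \<Rightarrow> 'b"
  where "lin_ext F x = (\<Sum>k\<in>Poly_Mapping.keys x. Poly_Mapping.lookup x k *\<^sub>C F k)"

lemma lin_ext_superset:
  assumes "finite K" "Poly_Mapping.keys x \<subseteq> K"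
  shows "lin_ext F x = (\<Sum>k\<in>K. Poly_Mapping.lookup x k *\<^sub>C F k)"
  unfolding lin_ext_def
  by (rule sum.mono_neutral_left) (use assms in \<open>auto simp: in_keys_iff\<close>)

lemma clinear_lin_ext: "clinear (lin_ext F)"
proof (rule clinearI)
  fix x y :: "'a \<Rightarrow>\<^sub>0 complex" and c
  let ?K = "Poly_Mapping.keys x \<union> Poly_Mapping.keys y"
  have "Poly_Mapping.keys (x + y) \<subseteq> ?K" "Poly_Mapping.keys (c *\<^sub>C x) \<subseteq> ?K"
    by (auto simp: in_keys_iff lookup_add lookup_scaleC)
  then show "lin_ext F (x + y) = lin_ext F x + lin_ext F y"
    and "lin_ext F (c *\<^sub>C x) = c *\<^sub>C lin_ext F x"
    by (simp_all add: lin_ext_superset[of ?K] lookup_add lookup_scaleC scaleC_add_left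
        sum.distrib complex_vector.scale_sum_right)
qed

lemma lin_ext_single [simp]: "lin_ext F (Poly_Mapping.single k c) = c *\<^sub>C F k"
  by (simp add: lin_ext_def)

lemma lin_ext_fun_add: "lin_ext (\<lambda>k. F k + G k) x = lin_ext F x + lin_ext G x"
  by (simp add: lin_ext_def scaleC_add_right sum.distrib)

lemma lin_ext_fun_scaleC: "lin_ext (\<lambda>k. c *\<^sub>C F k) x = c *\<^sub>C lin_ext F x"
  by (simp add: lin_ext_def complex_vector.scale_sum_right mult.commute)

lemma free_decomposition:
  "x = (\<Sum>k\<in>Poly_Mapping.keys x. Poly_Mapping.lookup x k *\<^sub>C Poly_Mapping.single k (1::complex))"
proof (rule poly_mapping_eqI)
  fix k
  have "(\<Sum>j\<in>Poly_Mapping.keys x. Poly_Mapping.lookup (Poly_Mapping.lookup x j *\<^sub>C Poly_Mapping.single j (1::complex)) k) =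
      (\<Sum>j\<in>Poly_Mapping.keys x. if j = k then Poly_Mapping.lookup x k else 0)"
    by (rule sum.cong) (auto simp: lookup_scaleC lookup_single when_def)
  also have "\<dots> = Poly_Mapping.lookup x k"
    by (simp add: sum.delta in_keys_iff)
  finally show "Poly_Mapping.lookup x k = Poly_Mapping.lookup
      (\<Sum>j\<in>Poly_Mapping.keys x. Poly_Mapping.lookup x j *\<^sub>C Poly_Mapping.single j (1::complex)) k"
    by (simp add: lookup_sum)
qed

lemma clinear_lin_ext_eq:
  assumes "clinear f"
  shows "f x = lin_ext (\<lambda>k. f (Poly_Mapping.single k 1)) x"
proof -
  have "f x = f (\<Sum>k\<in>Poly_Mapping.keys x. Poly_Mapping.lookup x k *\<^sub>C Poly_Mapping.single k 1)"
    using free_decomposition[of x] by (rule arg_cong)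
  also have "\<dots> = (\<Sum>k\<in>Poly_Mapping.keys x. f (Poly_Mapping.lookup x k *\<^sub>C Poly_Mapping.single k 1))"
    using module_hom.sum[OF module_hom_linearI[OF assms]] .
  finally show ?thesis
    by (simp add: lin_ext_def clinearD[OF assms])
qed

lemma clinear_span_zero:
  assumes "clinear f" "\<And>r. r \<in> R \<Longrightarrow> f r = 0" "x \<in> complex_vector.span R"
  shows "f x = 0"
  using assms(3)
  by (induction rule: complex_vector.span_induct_alt) (use assms in \<open>auto simp: clinearD\<close>)


lemma span_equivp: "equivp (\<lambda>x y :: 'a::complex_vector. x - y \<in> complex_vector.span R)"
proof (rule equivpI)
  show "reflp (\<lambda>x y :: 'a. x - y \<in> complex_vector.span R)"
    by (simp add: reflp_def complex_vector.span_zero)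
  show "symp (\<lambda>x y :: 'a. x - y \<in> complex_vector.span R)"
    by (metis (no_types, lifting) sympI minus_diff_eq complex_vector.span_neg)
  show "transp (\<lambda>x y :: 'a. x - y \<in> complex_vector.span R)"
    by (rule transpI) (metis (no_types, lifting) complex_vector.span_add diff_add_cancel add_diff_eq)
qed

lemma span_add_cong:
  fixes x :: "'a::complex_vector"
  assumes "x - x' \<in> complex_vector.span R" "y - y' \<in> complex_vector.span R"
  shows "(x + y) - (x' + y') \<in> complex_vector.span R"
  using complex_vector.span_add[OF assms] by (simp add: algebra_simps)

lemma span_diff_cong:
  fixes x :: "'a::complex_vector"
  assumes "x - x' \<in> complex_vector.span R" "y - y' \<in> complex_vector.span R"
  shows "(x - y) - (x' - y') \<in> complex_vector.span R"
  using complex_vector.span_diff[OF assms] by (simp add: algebra_simps)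

lemma span_uminus_cong:
  fixes x :: "'a::complex_vector"
  assumes "x - x' \<in> complex_vector.span R"
  shows "- x - (- x') \<in> complex_vector.span R"
  using complex_vector.span_neg[OF assms] by (simp add: algebra_simps)

lemma span_scaleC_cong:
  fixes x :: "'a::complex_vector"
  assumes "x - x' \<in> complex_vector.span R"
  shows "c *\<^sub>C x - c *\<^sub>C x' \<in> complex_vector.span R"
  using complex_vector.span_scale[OF assms, of c]
  by (simp add: complex_vector.scale_right_diff_distrib)

lemmas span_congs = span_add_cong span_diff_cong span_uminus_cong span_scaleC_cong


section \<open>Tensor products\<close>

definition tensor_relations :: "('v::complex_vector \<times> 'w::complex_vector \<Rightarrow>\<^sub>0 complex) set"
  where "tensor_relations =
    {Poly_Mapping.single (v + v', w) 1 - Poly_Mapping.single (v, w) 1 - Poly_Mapping.single (v', w) 1 | v v' w. True} \<union>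
    {Poly_Mapping.single (v, w + w') 1 - Poly_Mapping.single (v, w) 1 - Poly_Mapping.single (v, w') 1 | v w w'. True} \<union>
    {Poly_Mapping.single (c *\<^sub>C v, w) 1 - Poly_Mapping.single (v, w) c | c v w. True} \<union>
    {Poly_Mapping.single (v, c *\<^sub>C w) 1 - Poly_Mapping.single (v, w) c | c v w. True}"

definition tensor_rel :: "('v::complex_vector \<times> 'w::complex_vector \<Rightarrow>\<^sub>0 complex) \<Rightarrow>
    ('v \<times> 'w \<Rightarrow>\<^sub>0 complex) \<Rightarrow> bool"
  where "tensor_rel x y \<longleftrightarrow> x - y \<in> complex_vector.span tensor_relations"


quotient_type (overloaded) ('v, 'w) tensor = "'v::complex_vector \<times> 'w::complex_vector \<Rightarrow>\<^sub>0 complex" / tensor_rel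
  unfolding tensor_rel_def[abs_def] by (rule span_equivp)

instantiation tensor :: (complex_vector, complex_vector) complex_vector
begin

lift_definition zero_tensor :: "('a, 'b) tensor" is 0 .
lift_definition plus_tensor :: "('a, 'b) tensor \<Rightarrow> ('a, 'b) tensor \<Rightarrow> ('a, 'b) tensor" is "(+)"
  unfolding tensor_rel_def by (rule span_congs)
lift_definition minus_tensor :: "('a, 'b) tensor \<Rightarrow> ('a, 'b) tensor \<Rightarrow> ('a, 'b) tensor" is "(-)"
  unfolding tensor_rel_def by (rule span_congs)
lift_definition uminus_tensor :: "('a, 'b) tensor \<Rightarrow> ('a, 'b) tensor" is uminus
  unfolding tensor_rel_def by (rule span_congs)
lift_definition scaleC_tensor :: "complex \<Rightarrow> ('a, 'b) tensor \<Rightarrow> ('a, 'b) tensor" is scaleC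
  unfolding tensor_rel_def by (rule span_congs)

instance
  by standard
    (transfer, simp add: tensor_rel_def scaleC_add_left scaleC_add_right complex_vector.span_zero algebra_simps)+

end

lift_definition pure_tensor :: "'v::complex_vector \<Rightarrow> 'w::complex_vector \<Rightarrow> ('v, 'w) tensor"  (infixr \<open>\<otimes>\<close> 75)
  is "\<lambda>v w. Poly_Mapping.single (v, w) 1" .

text \<open>
  For bilinear \<open>B\<close>, this is the linear map with \<open>v \<otimes> w \<mapsto> B v w\<close>
  (lemmas \<open>clinear_tensor_lift\<close> and \<open>tensor_lift_pure\<close> below).  For other \<open>B\<close> the value
  depends on a choice of representatives, so every use below is with a bilinear \<open>B\<close>.
  In Sweedler notation, \<open>tensor_lift B (\<Delta> a)\<close> is \<open>B a\<^sub>(\<^sub>1\<^sub>) a\<^sub>(\<^sub>2\<^sub>)\<close>.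
\<close>

definition tensor_lift :: "('v::complex_vector \<Rightarrow> 'w::complex_vector \<Rightarrow> 'b::complex_vector) \<Rightarrow> ('v, 'w) tensor \<Rightarrow> 'b"
  where "tensor_lift B t = lin_ext (\<lambda>(v, w). B v w) (rep_tensor t)"

lemma tensor_lift_abs:
  assumes "cbilinear B"
  shows "tensor_lift B (abs_tensor x) = lin_ext (\<lambda>(v, w). B v w) x"
proof -
  let ?F = "lin_ext (\<lambda>(v, w). B v w)"
  have B: "clinear (\<lambda>v. B v w)" "clinear (B v)" for v w
    using assms by (auto simp: cbilinear_def)
  have "rep_tensor (abs_tensor x) - x \<in> complex_vector.span tensor_relations"
    using Quotient3_rep_abs[OF Quotient3_tensor, of x] Quotient3_rel[OF Quotient3_tensor]
      tensor.abs_eq_iff[of "rep_tensor (abs_tensor x)" x]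
      Quotient3_abs_rep[OF Quotient3_tensor, of "abs_tensor x"]
    by (simp add: tensor_rel_def)
  then have "?F (rep_tensor (abs_tensor x) - x) = 0"
    by (rule clinear_span_zero[OF clinear_lin_ext, rotated])
      (auto simp: tensor_relations_def clinearD[OF clinear_lin_ext] clinearD[OF B(1)] clinearD[OF B(2)])
  then show ?thesis
    by (simp add: tensor_lift_def clinearD[OF clinear_lin_ext])
qed

lemma tensor_lift_fun_add:
  "tensor_lift (\<lambda>v w. B v w + C v w) t = tensor_lift B t + tensor_lift C t"
  using lin_ext_fun_add[of "\<lambda>(v, w). B v w" "\<lambda>(v, w). C v w" "rep_tensor t"]
  by (simp add: tensor_lift_def split_def)

lemma tensor_lift_fun_scaleC: "tensor_lift (\<lambda>v w. c *\<^sub>C B v w) t = c *\<^sub>C tensor_lift B t"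
  using lin_ext_fun_scaleC[of c "\<lambda>(v, w). B v w" "rep_tensor t"]
  by (simp add: tensor_lift_def split_def)

lemma clinear_abs_tensor: "clinear abs_tensor"
  by (rule clinearI) (simp_all add: plus_tensor.abs_eq scaleC_tensor.abs_eq)

lemma clinear_tensor_lift:
  fixes B :: "'v::complex_vector \<Rightarrow> 'w::complex_vector \<Rightarrow> 'b::complex_vector"
  assumes "cbilinear B"
  shows "clinear (tensor_lift B)"
proof (rule clinearI)
  fix s t :: "('v, 'w) tensor" and c
  show "tensor_lift B (s + t) = tensor_lift B s + tensor_lift B t"
    by (induct s rule: tensor.abs_induct, induct t rule: tensor.abs_induct)
      (simp add: tensor_lift_abs[OF assms] plus_tensor.abs_eq clinearD[OF clinear_lin_ext])
  show "tensor_lift B (c *\<^sub>C t) = c *\<^sub>C tensor_lift B t"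
    by (induct t rule: tensor.abs_induct)
      (simp add: tensor_lift_abs[OF assms] scaleC_tensor.abs_eq clinearD[OF clinear_lin_ext])
qed

lemma tensor_lift_pure [simp]: "cbilinear B \<Longrightarrow> tensor_lift B (v \<otimes> w) = B v w"
  by (simp add: pure_tensor.abs_eq tensor_lift_abs)

lemma cbilinear_pure_tensor: "cbilinear (\<otimes>)"
proof (rule cbilinearI)
  fix v v' :: "'v::complex_vector" and w w' :: "'w::complex_vector" and c
  show "(v + v') \<otimes> w = v \<otimes> w + v' \<otimes> w"
    by transfer (unfold tensor_rel_def, rule complex_vector.span_base,
        unfold tensor_relations_def, rule UnI1, rule UnI1, rule UnI1, force simp: diff_diff_eq)
  show "v \<otimes> (w + w') = v \<otimes> w + v \<otimes> w'"
    by transfer (unfold tensor_rel_def, rule complex_vector.span_base,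
        unfold tensor_relations_def, rule UnI1, rule UnI1, rule UnI2, force simp: diff_diff_eq)
  show "(c *\<^sub>C v) \<otimes> w = c *\<^sub>C (v \<otimes> w)"
    by transfer (unfold tensor_rel_def, rule complex_vector.span_base,
        unfold tensor_relations_def, rule UnI1, rule UnI2, force simp: scaleC_single)
  show "v \<otimes> (c *\<^sub>C w) = c *\<^sub>C (v \<otimes> w)"
    by transfer (unfold tensor_rel_def, rule complex_vector.span_base,
        unfold tensor_relations_def, rule UnI2, force simp: scaleC_single)
qed

lemmas pure_tensor_bilinear = cbilinearD[OF cbilinear_pure_tensor]

lemma tensor_eqI:
  assumes "clinear f" "clinear g" "\<And>v w. f (v \<otimes> w) = g (v \<otimes> w)"
  shows "f t = g t"
proof (induct t rule: tensor.abs_induct)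
  case (1 x)
  have "clinear (\<lambda>x. f (abs_tensor x))" "clinear (\<lambda>x. g (abs_tensor x))"
    by (intro clinearI; simp add: clinearD[OF assms(1)] clinearD[OF assms(2)] clinearD[OF clinear_abs_tensor])+
  from clinear_lin_ext_eq[OF this(1), of x] clinear_lin_ext_eq[OF this(2), of x]
  have "f (abs_tensor x) = g (abs_tensor x)"
    using assms(3) by (simp add: pure_tensor.abs_eq lin_ext_def split_paired_all cong: sum.cong)
  then show ?case .
qed

definition tensor_map :: "('v::complex_vector \<Rightarrow> 'v'::complex_vector) \<Rightarrow> ('w::complex_vector \<Rightarrow> 'w'::complex_vector) \<Rightarrow>
    ('v, 'w) tensor \<Rightarrow> ('v', 'w') tensor"
  where "tensor_map f g = tensor_lift (\<lambda>v w. f v \<otimes> g w)"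

definition tensor_assoc :: "(('u::complex_vector, 'v::complex_vector) tensor, 'w::complex_vector) tensor \<Rightarrow>
    ('u, ('v, 'w) tensor) tensor"
  where "tensor_assoc = tensor_lift (\<lambda>t w. tensor_lift (\<lambda>u v. u \<otimes> (v \<otimes> w)) t)"

instantiation tensor :: (complex_algebra, complex_algebra) complex_algebra
begin

definition one_tensor :: "('a, 'b) tensor"
  where "1 = (1::'a) \<otimes> (1::'b)"

definition times_tensor :: "('a, 'b) tensor \<Rightarrow> ('a, 'b) tensor \<Rightarrow> ('a, 'b) tensor"
  where "s * t = tensor_lift (\<lambda>a b. tensor_lift (\<lambda>c d. (a * c) \<otimes> (b * d)) t) s"

lemma cbilinear_times_aux:
  "cbilinear (\<lambda>c d. (a * c) \<otimes> (b * d))"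
  "cbilinear (\<lambda>(a::'a) (b::'b). tensor_lift (\<lambda>c d. (a * c) \<otimes> (b * d)) t)"
  for a :: 'a and b :: 'b
proof -
  show "cbilinear (\<lambda>c d. (a * c) \<otimes> (b * d))"
    by (rule cbilinearI) (simp_all add: pure_tensor_bilinear algebra_simps)
  show "cbilinear (\<lambda>(a::'a) (b::'b). tensor_lift (\<lambda>c d. (a * c) \<otimes> (b * d)) t)"
    by (rule cbilinearI)
      (simp_all add: pure_tensor_bilinear distrib_right tensor_lift_fun_add tensor_lift_fun_scaleC)
qed

lemma times_pure_tensor: "(a \<otimes> b) * (c \<otimes> d) = (a * c) \<otimes> (b * d)"
  for a c :: 'a and b d :: 'b
  unfolding times_tensor_def tensor_lift_pure[OF cbilinear_times_aux(2)]
  by (rule tensor_lift_pure[OF cbilinear_times_aux(1)])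

lemma cbilinear_times_tensor: "cbilinear ((*) :: ('a, 'b) tensor \<Rightarrow> _)"
  by (rule cbilinearI)
    (simp_all add: times_tensor_def clinearD[OF clinear_tensor_lift] cbilinear_times_aux
      tensor_lift_fun_add tensor_lift_fun_scaleC)

instance
proof
  note bil = cbilinearD[OF cbilinear_times_tensor]
  fix r s t :: "('a, 'b) tensor" and c
  show "(r + s) * t = r * t + s * t" "r * (s + t) = r * s + r * t"
    "(c *\<^sub>C r) * s = c *\<^sub>C (r * s)" "r * c *\<^sub>C s = c *\<^sub>C (r * s)"
    by (fact bil)+
  show "1 * r = r"
    by (rule tensor_eqI[where f = "\<lambda>r. 1 * r"])
      (auto intro!: clinearI simp: bil one_tensor_def times_pure_tensor)
  show "r * 1 = r"
    by (rule tensor_eqI[where f = "\<lambda>r. r * 1"])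
      (auto intro!: clinearI simp: bil one_tensor_def times_pure_tensor)
  have "u * v * w = u * (v * w)" if "\<And>a b x y. (a \<otimes> b) * (x \<otimes> y) * w = (a \<otimes> b) * ((x \<otimes> y) * w)"
    for u v w :: "('a, 'b) tensor"
  proof (rule tensor_eqI[where f = "\<lambda>u. u * v * w" and g = "\<lambda>u. u * (v * w)"])
    show "(a \<otimes> b) * v * w = (a \<otimes> b) * (v * w)" for a b
      by (rule tensor_eqI[where f = "\<lambda>v. (a \<otimes> b) * v * w" and g = "\<lambda>v. (a \<otimes> b) * (v * w)"])
        (auto intro!: clinearI that simp: bil)
  qed (auto intro!: clinearI simp: bil)
  moreover have "(a \<otimes> b) * (x \<otimes> y) * w = (a \<otimes> b) * ((x \<otimes> y) * w)" for a b x y and w :: "('a, 'b) tensor"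
    by (rule tensor_eqI[where f = "\<lambda>w. (a \<otimes> b) * (x \<otimes> y) * w"])
      (auto intro!: clinearI simp: bil times_pure_tensor mult.assoc)
  ultimately show "r * s * t = r * (s * t)"
    by blast
qed

end


section \<open>The tensor algebra\<close>

text \<open>
  \<open>T(V)\<close> is the quotient of the free vector space on all words \<open>[v\<^sub>1, \<dots>, v\<^sub>n]\<close> by
  the multilinearity relations in each position.  Each relation only involves words of a
  single length \<open>n\<close>, so this is the direct sum over \<open>n\<close> of the spaces spanned by
  words of length \<open>n\<close> modulo multilinearity, that is, of the tensor powers of \<open>V\<close>;
  the empty word spans the degree zero part, a copy of the complex numbers.
\<close>

definition word_relations :: "('v::complex_vector list \<Rightarrow>\<^sub>0 complex) set"
  where "word_relations =
    {Poly_Mapping.single (us @ (v + v') # ws) 1 - Poly_Mapping.single (us @ v # ws) 1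
       - Poly_Mapping.single (us @ v' # ws) 1 | us v v' ws. True} \<union>
    {Poly_Mapping.single (us @ (c *\<^sub>C v) # ws) 1 - Poly_Mapping.single (us @ v # ws) c | c us v ws. True}"

definition word_rel :: "('v::complex_vector list \<Rightarrow>\<^sub>0 complex) \<Rightarrow> ('v list \<Rightarrow>\<^sub>0 complex) \<Rightarrow> bool"
  where "word_rel x y \<longleftrightarrow> x - y \<in> complex_vector.span word_relations"

quotient_type (overloaded) 'v tensor_algebra = "'v::complex_vector list \<Rightarrow>\<^sub>0 complex" / word_rel
  unfolding word_rel_def[abs_def] by (rule span_equivp)

instantiation tensor_algebra :: (complex_vector) complex_vector
begin

lift_definition zero_tensor_algebra :: "'a tensor_algebra" is 0 .
lift_definition plus_tensor_algebra :: "'a tensor_algebra \<Rightarrow> 'a tensor_algebra \<Rightarrow> 'a tensor_algebra" is "(+)"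
  unfolding word_rel_def by (rule span_congs)
lift_definition minus_tensor_algebra :: "'a tensor_algebra \<Rightarrow> 'a tensor_algebra \<Rightarrow> 'a tensor_algebra" is "(-)"
  unfolding word_rel_def by (rule span_congs)
lift_definition uminus_tensor_algebra :: "'a tensor_algebra \<Rightarrow> 'a tensor_algebra" is uminus
  unfolding word_rel_def by (rule span_congs)
lift_definition scaleC_tensor_algebra :: "complex \<Rightarrow> 'a tensor_algebra \<Rightarrow> 'a tensor_algebra" is scaleC
  unfolding word_rel_def by (rule span_congs)

instance
  by standard
    (transfer, simp add: word_rel_def scaleC_add_left scaleC_add_right complex_vector.span_zero algebra_simps)+

end

text \<open>The class of the word \<open>[v\<^sub>1, \<dots>, v\<^sub>n]\<close> is \<open>v\<^sub>1 \<otimes> \<dots> \<otimes> v\<^sub>n\<close>.\<close>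

lift_definition pure_word :: "'v::complex_vector list \<Rightarrow> 'v tensor_algebra"
  is "\<lambda>vs. Poly_Mapping.single vs 1" .

definition multilinear :: "('v::complex_vector list \<Rightarrow> 'b::complex_vector) \<Rightarrow> bool"
  where "multilinear F \<longleftrightarrow> (\<forall>us ws. clinear (\<lambda>v. F (us @ v # ws)))"

text \<open>
  The linear map with \<open>pure_word vs \<mapsto> F vs\<close>; as for \<open>tensor_lift\<close>, this is
  meaningful (and used below) for multilinear \<open>F\<close> only.
\<close>

definition word_lift :: "('v::complex_vector list \<Rightarrow> 'b::complex_vector) \<Rightarrow> 'v tensor_algebra \<Rightarrow> 'b"
  where "word_lift F t = lin_ext F (rep_tensor_algebra t)"

lemma multilinearI:
  assumes "\<And>us v v' ws. F (us @ (v + v') # ws) = F (us @ v # ws) + F (us @ v' # ws)"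
    and "\<And>c us v ws. F (us @ (c *\<^sub>C v) # ws) = c *\<^sub>C F (us @ v # ws)"
  shows "multilinear F"
  unfolding multilinear_def by (intro allI clinearI assms)

lemma multilinearD:
  assumes "multilinear F"
  shows "F (us @ (v + v') # ws) = F (us @ v # ws) + F (us @ v' # ws)"
    and "F (us @ (c *\<^sub>C v) # ws) = c *\<^sub>C F (us @ v # ws)"
  using assms clinearD[of "\<lambda>v. F (us @ v # ws)"] by (simp_all add: multilinear_def)

lemma word_lift_abs:
  assumes "multilinear F"
  shows "word_lift F (abs_tensor_algebra x) = lin_ext F x"
proof -
  have "rep_tensor_algebra (abs_tensor_algebra x) - x \<in> complex_vector.span word_relations"
    using tensor_algebra.abs_eq_iff[of "rep_tensor_algebra (abs_tensor_algebra x)" x]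
      Quotient3_abs_rep[OF Quotient3_tensor_algebra, of "abs_tensor_algebra x"]
    by (simp add: word_rel_def)
  then have "lin_ext F (rep_tensor_algebra (abs_tensor_algebra x) - x) = 0"
    by (rule clinear_span_zero[OF clinear_lin_ext, rotated])
      (auto simp: word_relations_def clinearD[OF clinear_lin_ext] multilinearD[OF assms])
  then show ?thesis
    by (simp add: word_lift_def clinearD[OF clinear_lin_ext])
qed

lemma word_lift_fun_add: "word_lift (\<lambda>vs. F vs + G vs) t = word_lift F t + word_lift G t"
  by (simp add: word_lift_def lin_ext_fun_add)

lemma word_lift_fun_scaleC: "word_lift (\<lambda>vs. c *\<^sub>C F vs) t = c *\<^sub>C word_lift F t"
  by (simp add: word_lift_def lin_ext_fun_scaleC)

lemma clinear_word_lift: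
  fixes F :: "'v::complex_vector list \<Rightarrow> 'b::complex_vector"
  assumes "multilinear F"
  shows "clinear (word_lift F)"
proof (rule clinearI)
  fix s t :: "'v tensor_algebra" and c
  show "word_lift F (s + t) = word_lift F s + word_lift F t"
    by (induct s rule: tensor_algebra.abs_induct, induct t rule: tensor_algebra.abs_induct)
      (simp add: word_lift_abs[OF assms] plus_tensor_algebra.abs_eq clinearD[OF clinear_lin_ext])
  show "word_lift F (c *\<^sub>C t) = c *\<^sub>C word_lift F t"
    by (induct t rule: tensor_algebra.abs_induct)
      (simp add: word_lift_abs[OF assms] scaleC_tensor_algebra.abs_eq clinearD[OF clinear_lin_ext])
qed

lemma word_lift_pure [simp]: "multilinear F \<Longrightarrow> word_lift F (pure_word vs) = F vs"
  by (simp add: pure_word.abs_eq word_lift_abs)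

lemma multilinear_pure_word: "multilinear pure_word"
proof (rule multilinearI)
  fix us ws :: "'v::complex_vector list" and v v' :: 'v and c
  show "pure_word (us @ (v + v') # ws) = pure_word (us @ v # ws) + pure_word (us @ v' # ws)"
    by transfer (unfold word_rel_def, rule complex_vector.span_base,
        unfold word_relations_def, rule UnI1, force simp: diff_diff_eq)
  show "pure_word (us @ (c *\<^sub>C v) # ws) = c *\<^sub>C pure_word (us @ v # ws)"
    by transfer (unfold word_rel_def, rule complex_vector.span_base,
        unfold word_relations_def, rule UnI2, force simp: scaleC_single)
qed

lemma word_eqI:
  assumes "clinear f" "clinear g" "\<And>vs. f (pure_word vs) = g (pure_word vs)"
  shows "f t = g t"
proof (induct t rule: tensor_algebra.abs_induct)
  case (1 x)
  have "clinear (\<lambda>x. f (abs_tensor_algebra x))" "clinear (\<lambda>x. g (abs_tensor_algebra x))"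
    by (intro clinearI; simp add: clinearD[OF assms(1)] clinearD[OF assms(2)]
        plus_tensor_algebra.abs_eq[symmetric] scaleC_tensor_algebra.abs_eq[symmetric])+
  from clinear_lin_ext_eq[OF this(1), of x] clinear_lin_ext_eq[OF this(2), of x]
  have "f (abs_tensor_algebra x) = g (abs_tensor_algebra x)"
    using assms(3) by (simp add: pure_word.abs_eq)
  then show ?case .
qed

instantiation tensor_algebra :: (complex_vector) complex_algebra
begin

definition one_tensor_algebra :: "'a tensor_algebra"
  where "1 = pure_word []"

definition times_tensor_algebra :: "'a tensor_algebra \<Rightarrow> 'a tensor_algebra \<Rightarrow> 'a tensor_algebra"
  where "s * t = word_lift (\<lambda>vs. word_lift (\<lambda>ws. pure_word (vs @ ws)) t) s"

lemma multilinear_times_aux: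
  "multilinear (\<lambda>ws. pure_word (vs @ ws))"
  "multilinear (\<lambda>vs. word_lift (\<lambda>ws. pure_word (vs @ ws)) t)"
  for vs :: "'a list"
proof -
  note D = multilinearD[OF multilinear_pure_word]
  show "multilinear (\<lambda>ws. pure_word (vs @ ws))"
    by (rule multilinearI) (metis D append.assoc)+
  show "multilinear (\<lambda>vs. word_lift (\<lambda>ws. pure_word (vs @ ws)) t)"
    by (rule multilinearI) (simp_all add: D word_lift_fun_add word_lift_fun_scaleC)
qed

lemma times_pure_word: "pure_word vs * pure_word ws = pure_word (vs @ ws)"
  for vs ws :: "'a list"
  unfolding times_tensor_algebra_def word_lift_pure[OF multilinear_times_aux(2)]
  by (rule word_lift_pure[OF multilinear_times_aux(1)])

lemma cbilinear_times_tensor_algebra: "cbilinear ((*) :: 'a tensor_algebra \<Rightarrow> _)"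
  by (rule cbilinearI)
    (simp_all add: times_tensor_algebra_def clinearD[OF clinear_word_lift] multilinear_times_aux
      word_lift_fun_add word_lift_fun_scaleC)

instance
proof
  note bil = cbilinearD[OF cbilinear_times_tensor_algebra]
  fix r s t :: "'a tensor_algebra" and c
  show "(r + s) * t = r * t + s * t" "r * (s + t) = r * s + r * t"
    "(c *\<^sub>C r) * s = c *\<^sub>C (r * s)" "r * c *\<^sub>C s = c *\<^sub>C (r * s)"
    by (fact bil)+
  show "1 * r = r"
    by (rule word_eqI[where f = "\<lambda>r. 1 * r"])
      (auto intro!: clinearI simp: bil one_tensor_algebra_def times_pure_word)
  show "r * 1 = r"
    by (rule word_eqI[where f = "\<lambda>r. r * 1"])
      (auto intro!: clinearI simp: bil one_tensor_algebra_def times_pure_word)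
  have 1: "pure_word u * pure_word v * w = pure_word u * (pure_word v * w)"
    for u v and w :: "'a tensor_algebra"
    by (rule word_eqI[where f = "\<lambda>w. pure_word u * pure_word v * w"])
      (auto intro!: clinearI simp: bil times_pure_word)
  have 2: "pure_word u * v * w = pure_word u * (v * w)" for u and v w :: "'a tensor_algebra"
    by (rule word_eqI[where f = "\<lambda>v. pure_word u * v * w" and g = "\<lambda>v. pure_word u * (v * w)"])
      (auto intro!: clinearI simp: bil 1)
  show "r * s * t = r * (s * t)"
    by (rule word_eqI[where f = "\<lambda>r. r * s * t" and g = "\<lambda>r. r * (s * t)"])
      (auto intro!: clinearI simp: bil 2)
qed

end

definition tensor_incl :: "'v::complex_vector \<Rightarrow> 'v tensor_algebra"
  where "tensor_incl v = pure_word [v]"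


section \<open>Hopf star-algebras\<close>

locale hopf_algebra =
  fixes \<Delta> :: "'h::complex_algebra \<Rightarrow> ('h, 'h) tensor"
    and \<epsilon> :: "'h \<Rightarrow> complex"
    and S :: "'h \<Rightarrow> 'h"
  assumes coproduct_hom: "algebra_hom \<Delta>"
    and counit_hom: "algebra_hom \<epsilon>"
    and antipode_linear: "clinear S"
    and coassoc: "tensor_assoc (tensor_map \<Delta> id (\<Delta> a)) = tensor_map id \<Delta> (\<Delta> a)"
    and counit_left: "tensor_lift (\<lambda>x y. \<epsilon> x *\<^sub>C y) (\<Delta> a) = a"
    and counit_right: "tensor_lift (\<lambda>x y. \<epsilon> y *\<^sub>C x) (\<Delta> a) = a"
    and antipode_left: "tensor_lift (\<lambda>x y. S x * y) (\<Delta> a) = \<epsilon> a *\<^sub>C 1"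
    and antipode_right: "tensor_lift (\<lambda>x y. x * S y) (\<Delta> a) = \<epsilon> a *\<^sub>C 1"

text \<open>
  The map \<open>x \<otimes> y \<mapsto> x\<^sup>* \<otimes> y\<^sup>*\<close> is antilinear; composed with \<open>Bar\<close> it
  becomes linear, so that \<open>tensor_lift\<close> applies to it in \<open>coproduct_star\<close>.
\<close>

locale hopf_star_algebra = hopf_algebra \<Delta> \<epsilon> S
  for \<Delta> :: "'h::complex_algebra \<Rightarrow> ('h, 'h) tensor" and \<epsilon> S +
  fixes star :: "'h \<Rightarrow> 'h"
  assumes star_antilinear: "antilinear star"
    and star_star: "star (star a) = a"
    and star_mult: "star (a * b) = star b * star a"
    and coproduct_star: "\<Delta> (star a) = unbar (tensor_lift (\<lambda>x y. Bar (star x \<otimes> star y)) (\<Delta> a))"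


section \<open>Modules and star-modules\<close>

definition hmodule :: "('h::complex_algebra \<Rightarrow> 'v::complex_vector \<Rightarrow> 'v) \<Rightarrow> bool"
  where "hmodule act \<longleftrightarrow> cbilinear act \<and> (\<forall>v. act 1 v = v) \<and> (\<forall>a b v. act (a * b) v = act a (act b v))"

definition module_map ::
    "('h \<Rightarrow> 'v::complex_vector \<Rightarrow> 'v) \<Rightarrow> ('h \<Rightarrow> 'w::complex_vector \<Rightarrow> 'w) \<Rightarrow> ('v \<Rightarrow> 'w) \<Rightarrow> bool"
  where "module_map actV actW T \<longleftrightarrow> clinear T \<and> (\<forall>a v. T (actV a v) = actW a (T v))"

definition conj_act :: "('h \<Rightarrow> 'h) \<Rightarrow> ('h \<Rightarrow> 'h) \<Rightarrow> ('h \<Rightarrow> 'v \<Rightarrow> 'v) \<Rightarrow> 'h \<Rightarrow> 'v conjugate \<Rightarrow> 'v conjugate"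
  where "conj_act S star act a x = Bar (act (star (S a)) (unbar x))"

definition star_structure ::
    "('h \<Rightarrow> 'h) \<Rightarrow> ('h \<Rightarrow> 'h) \<Rightarrow> ('h \<Rightarrow> 'v::complex_vector \<Rightarrow> 'v) \<Rightarrow> ('v conjugate \<Rightarrow> 'v) \<Rightarrow> bool"
  where "star_structure S star act s \<longleftrightarrow>
    module_map (conj_act S star act) act s \<and> s \<circ> conj_map s = conj_sigma"

definition star_module ::
    "('h::complex_algebra \<Rightarrow> 'h) \<Rightarrow> ('h \<Rightarrow> 'h) \<Rightarrow> ('h \<Rightarrow> 'v::complex_vector \<Rightarrow> 'v) \<Rightarrow> ('v conjugate \<Rightarrow> 'v) \<Rightarrow> bool"
  where "star_module S star act s \<longleftrightarrow> hmodule act \<and> star_structure S star act s"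

definition star_map ::
    "('v::complex_vector conjugate \<Rightarrow> 'v) \<Rightarrow> ('w::complex_vector conjugate \<Rightarrow> 'w) \<Rightarrow> ('v \<Rightarrow> 'w) \<Rightarrow> bool"
  where "star_map sV sW T \<longleftrightarrow> clinear T \<and> T \<circ> sV = sW \<circ> conj_map T"

definition star_module_map ::
    "('h \<Rightarrow> 'v::complex_vector \<Rightarrow> 'v) \<Rightarrow> ('v conjugate \<Rightarrow> 'v) \<Rightarrow>
     ('h \<Rightarrow> 'w::complex_vector \<Rightarrow> 'w) \<Rightarrow> ('w conjugate \<Rightarrow> 'w) \<Rightarrow> ('v \<Rightarrow> 'w) \<Rightarrow> bool"
  where "star_module_map actV sV actW sW T \<longleftrightarrow> star_map sV sW T \<and> module_map actV actW T"


section \<open>Algebras and star-algebras in the category of modules\<close>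

definition module_algebra ::
    "('h::complex_algebra \<Rightarrow> ('h, 'h) tensor) \<Rightarrow> ('h \<Rightarrow> complex) \<Rightarrow> ('h \<Rightarrow> 'a::complex_algebra \<Rightarrow> 'a) \<Rightarrow> bool"
  where "module_algebra \<Delta> \<epsilon> act \<longleftrightarrow> hmodule act \<and>
    (\<forall>a x y. act a (x * y) = tensor_lift (\<lambda>b c. act b x * act c y) (\<Delta> a)) \<and>
    (\<forall>a. act a 1 = \<epsilon> a *\<^sub>C 1)"

definition module_algebra_hom ::
    "('h \<Rightarrow> 'a::complex_algebra \<Rightarrow> 'a) \<Rightarrow> ('h \<Rightarrow> 'b::complex_algebra \<Rightarrow> 'b) \<Rightarrow> ('a \<Rightarrow> 'b) \<Rightarrow> bool"
  where "module_algebra_hom actA actB F \<longleftrightarrow> module_map actA actB F \<and> algebra_hom F"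

text \<open>
  The product on \<open>'a conjugate\<close> is \<open>Bar x * Bar y = Bar (y * x)\<close>, so that
  \<open>algebra_hom s\<close> says that \<open>s\<close> is antimultiplicative as a map on \<open>'a\<close>.
\<close>

definition star_algebra ::
    "('h::complex_algebra \<Rightarrow> ('h, 'h) tensor) \<Rightarrow> ('h \<Rightarrow> complex) \<Rightarrow> ('h \<Rightarrow> 'h) \<Rightarrow> ('h \<Rightarrow> 'h) \<Rightarrow>
     ('h \<Rightarrow> 'a::complex_algebra \<Rightarrow> 'a) \<Rightarrow> ('a conjugate \<Rightarrow> 'a) \<Rightarrow> bool"
  where "star_algebra \<Delta> \<epsilon> S star act s \<longleftrightarrow>
    module_algebra \<Delta> \<epsilon> act \<and> star_structure S star act s \<and> algebra_hom s"

definition star_algebra_hom ::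
    "('h \<Rightarrow> 'a::complex_algebra \<Rightarrow> 'a) \<Rightarrow> ('a conjugate \<Rightarrow> 'a) \<Rightarrow>
     ('h \<Rightarrow> 'b::complex_algebra \<Rightarrow> 'b) \<Rightarrow> ('b conjugate \<Rightarrow> 'b) \<Rightarrow> ('a \<Rightarrow> 'b) \<Rightarrow> bool"
  where "star_algebra_hom actA sA actB sB F \<longleftrightarrow> algebra_hom F \<and> star_module_map actA sA actB sB F"


section \<open>The module and star structures on the tensor algebra\<close>

text \<open>
  Iterating the action on a tensor product of two modules, starting from the trivial module
  in degree zero.
\<close>

primrec word_act ::
    "('h::complex_algebra \<Rightarrow> ('h, 'h) tensor) \<Rightarrow> ('h \<Rightarrow> complex) \<Rightarrow> ('h \<Rightarrow> 'v::complex_vector \<Rightarrow> 'v) \<Rightarrow>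
     'h \<Rightarrow> 'v list \<Rightarrow> 'v tensor_algebra"
  where
    "word_act \<Delta> \<epsilon> act a [] = \<epsilon> a *\<^sub>C 1"
  | "word_act \<Delta> \<epsilon> act a (v # vs) =
       tensor_lift (\<lambda>b c. tensor_incl (act b v) * word_act \<Delta> \<epsilon> act c vs) (\<Delta> a)"

definition tensor_act ::
    "('h::complex_algebra \<Rightarrow> ('h, 'h) tensor) \<Rightarrow> ('h \<Rightarrow> complex) \<Rightarrow> ('h \<Rightarrow> 'v::complex_vector \<Rightarrow> 'v) \<Rightarrow>
     'h \<Rightarrow> 'v tensor_algebra \<Rightarrow> 'v tensor_algebra"
  where "tensor_act \<Delta> \<epsilon> act a = word_lift (word_act \<Delta> \<epsilon> act a)"

text \<open>
  \<open>Bar (v\<^sub>1 \<otimes> \<dots> \<otimes> v\<^sub>n) \<mapsto> s (Bar v\<^sub>n) \<otimes> \<dots> \<otimes> s (Bar v\<^sub>1)\<close>.  As this depends antilinearly on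
  the \<open>v\<^sub>i\<close>, the extension is again made with values in the conjugate space.
\<close>

definition tensor_star ::
    "('v::complex_vector conjugate \<Rightarrow> 'v) \<Rightarrow> 'v tensor_algebra conjugate \<Rightarrow> 'v tensor_algebra"
  where "tensor_star s x =
    unbar (word_lift (\<lambda>vs. Bar (pure_word (rev (map (\<lambda>v. s (Bar v)) vs)))) (unbar x))"

end

theory Submission
  imports Defs
begin

text \<open>
  Two algebra homomorphisms out of \<open>T(V)\<close> that agree on \<open>V\<close> are equal, because products of
  elements of \<open>V\<close> span \<open>T(V)\<close> (\<open>tensor_algebra_hom_eqI\<close>).  Conjugation transports this to
  homomorphisms out of \<open>T(V)\<close> conjugate (\<open>conj_tensor_algebra_hom_eqI\<close>).  If a homomorphism \<open>F\<close>
  extends \<open>f\<close>, then \<open>F \<circ> *\<close> and \<open>* \<circ> conj F\<close> are two homomorphisms from the conjugate of \<open>T(V)\<close> to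
  \<open>A\<close>, and on generators they agree because \<open>f\<close> is a star-map; so \<open>F\<close> is a star-map
  (\<open>star_map_algebra_hom\<close>).  The same two principles give the uniqueness of \<open>F\<close>, the uniqueness
  of the star-structure on \<open>T(V)\<close>, and the fact that it is an involution.

  Existence is the larger part.  Words act through the iterated coproduct.  Coassociativity makes
  \<open>T(V)\<close> a module algebra (\<open>module_algebra_tensor_act\<close>), and induction on words shows that the
  algebra homomorphism induced by a module map is a module map (\<open>module_map_tensor_hom\<close>).  The
  delicate point is that the star of \<open>T(V)\<close> is a module map.  It reverses products, so this
  requires that \<open>a \<mapsto> S(a)\<^sup>*\<close> reverses the coproduct, and hence that the antipode does:
  \<open>\<Delta>(S a) = S a\<^sub>(\<^sub>2\<^sub>) \<otimes> S a\<^sub>(\<^sub>1\<^sub>)\<close>  (\<open>coproduct_antipode\<close>).  For the convolution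
  product one side is a left and the other a right inverse of \<open>\<Delta>\<close>, so they are equal.
\<close>


section \<open>Linear maps and lifts\<close>

text \<open>
  A lift is evaluated on a chosen representative, as a finite linear combination of values of
  the function that is lifted.  Hence linear maps pass through \<open>tensor_lift\<close>, and two lifts can
  be interchanged like two finite sums.
\<close>

lemma lin_ext_commute:
  assumes "clinear g"
  shows "g (lin_ext F x) = lin_ext (\<lambda>k. g (F k)) x"
  unfolding lin_ext_def
  by (simp add: module_hom.sum[OF module_hom_linearI[OF assms]] clinearD[OF assms])

lemma tensor_lift_commute:
  assumes "clinear g"
  shows "g (tensor_lift B t) = tensor_lift (\<lambda>x y. g (B x y)) t"
  unfolding tensor_lift_def by (simp add: lin_ext_commute[OF assms] split_def)

lemma tensor_lift_swap:
  "tensor_lift (\<lambda>x y. tensor_lift (\<lambda>u v. T x y u v) s) t =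
   tensor_lift (\<lambda>u v. tensor_lift (\<lambda>x y. T x y u v) t) s"
  unfolding tensor_lift_def lin_ext_def split_def complex_vector.scale_sum_right
  by (subst sum.swap) (simp add: mult.commute)

lemma tensor_lift_pure_tensor: "tensor_lift (\<otimes>) t = t"
  by (rule tensor_eqI[where g = "\<lambda>t. t"])
    (auto intro!: clinearI simp: clinearD[OF clinear_tensor_lift] cbilinear_pure_tensor)

lemma cbilinear_times: "cbilinear ((*) :: 'a::complex_algebra \<Rightarrow> _)"
  by (rule cbilinearI) (simp_all add: distrib_left distrib_right)

lemma mult_tensor_lift:
  fixes s :: "'a::complex_algebra"
  shows "s * tensor_lift B t = tensor_lift (\<lambda>x y. s * B x y) t"
    and "tensor_lift B t * s = tensor_lift (\<lambda>x y. B x y * s) t"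
  by (rule tensor_lift_commute, use cbilinear_times in \<open>auto simp: cbilinear_def\<close>)+

lemma pure_tensor_lift:
  "s \<otimes> tensor_lift B t = tensor_lift (\<lambda>x y. s \<otimes> B x y) t"
  "tensor_lift B t \<otimes> s = tensor_lift (\<lambda>x y. B x y \<otimes> s) t"
  by (rule tensor_lift_commute, use cbilinear_pure_tensor in \<open>auto simp: cbilinear_def\<close>)+

lemma clinear_comp: "clinear f \<Longrightarrow> clinear g \<Longrightarrow> clinear (\<lambda>x. f (g x))"
  by (rule clinearI) (simp_all add: clinearD)

lemma cbilinear_comp:
  "cbilinear B \<Longrightarrow> clinear f \<Longrightarrow> clinear g \<Longrightarrow> cbilinear (\<lambda>x y. B (f x) (g y))"
  by (rule cbilinearI) (simp_all add: clinearD cbilinearD)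

lemma clinear_id: "clinear (\<lambda>x. x)"
  by (rule clinearI) simp_all

lemma clinear_cbilinear: "clinear g \<Longrightarrow> cbilinear B \<Longrightarrow> cbilinear (\<lambda>x y. g (B x y))"
  by (rule cbilinearI) (simp_all add: clinearD cbilinearD)

lemma cbilinear_scale_left: "clinear e \<Longrightarrow> clinear g \<Longrightarrow> cbilinear (\<lambda>x y. e x *\<^sub>C g y)"
  by (rule cbilinearI) (simp_all add: clinearD scaleC_add_left scaleC_add_right mult.commute)

definition ctrilinear ::
    "('u::complex_vector \<Rightarrow> 'v::complex_vector \<Rightarrow> 'w::complex_vector \<Rightarrow> 'b::complex_vector) \<Rightarrow> bool"
  where "ctrilinear T \<longleftrightarrow> (\<forall>x. cbilinear (T x)) \<and> (\<forall>y z. clinear (\<lambda>x. T x y z))"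

lemma ctrilinear_product:
  fixes f :: "'u::complex_vector \<Rightarrow> 'a::complex_algebra"
  assumes "clinear f" "clinear g" "clinear h"
  shows "ctrilinear (\<lambda>x y z. f x * (g y * h z))"
  unfolding ctrilinear_def
  by (intro conjI allI cbilinearI clinearI)
    (simp_all add: clinearD[OF assms(1)] clinearD[OF assms(2)] clinearD[OF assms(3)]
      distrib_left distrib_right)


section \<open>Convolution and the antipode\<close>

text \<open>
  The convolution product of linear maps \<open>f\<close> and \<open>g\<close> from \<open>H\<close> to an algebra is
  \<open>a \<mapsto> f a\<^sub>(\<^sub>1\<^sub>) * g a\<^sub>(\<^sub>2\<^sub>)\<close>, that is, \<open>tensor_lift (\<lambda>x y. f x * g y) (\<Delta> a)\<close>; its unit is
  \<open>a \<mapsto> \<epsilon> a *\<^sub>C 1\<close>.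
\<close>

context hopf_algebra
begin

lemma coproduct_linear: "clinear \<Delta>"
  and coproduct_mult: "\<Delta> (a * b) = \<Delta> a * \<Delta> b"
  and coproduct_one: "\<Delta> 1 = 1 \<otimes> 1"
  using coproduct_hom by (auto simp: algebra_hom_def one_tensor_def)

lemma counit_linear: "clinear \<epsilon>"
  and counit_mult: "\<epsilon> (a * b) = \<epsilon> a * \<epsilon> b"
  and counit_one: "\<epsilon> 1 = 1"
  using counit_hom by (auto simp: algebra_hom_def)

lemma clinear_tensor_lift_coproduct:
  "cbilinear B \<Longrightarrow> clinear (\<lambda>a. tensor_lift B (\<Delta> a))"
  by (rule clinear_comp[OF clinear_tensor_lift coproduct_linear])

lemma tensor_lift_coproduct_mult:
  assumes "cbilinear B"
  shows "tensor_lift B (\<Delta> (a * b)) =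
    tensor_lift (\<lambda>x y. tensor_lift (\<lambda>u w. B (x * u) (y * w)) (\<Delta> b)) (\<Delta> a)"
  by (simp add: coproduct_mult times_tensor_def tensor_lift_commute[OF clinear_tensor_lift[OF assms]]
      tensor_lift_pure[OF assms])

text \<open>
  Coassociativity in Sweedler form: a trilinear expression in \<open>a\<^sub>(\<^sub>1\<^sub>), a\<^sub>(\<^sub>2\<^sub>), a\<^sub>(\<^sub>3\<^sub>)\<close> has the same value
  whether the first or the second leg of \<open>\<Delta> a\<close> is split.  It is the image of the axiom under
  the linear map \<open>L\<close> that \<open>T\<close> induces on the triple tensor product.
\<close>

lemma coassoc_lift:
  fixes T :: "'h \<Rightarrow> 'h \<Rightarrow> 'h \<Rightarrow> 'b::complex_vector"
  assumes "ctrilinear T"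
  shows "tensor_lift (\<lambda>x z. tensor_lift (\<lambda>u v. T u v z) (\<Delta> x)) (\<Delta> a) =
    tensor_lift (\<lambda>u z. tensor_lift (T u) (\<Delta> z)) (\<Delta> a)"
proof -
  have T23: "cbilinear (T u)" and T1: "clinear (\<lambda>x. T x y z)" for u y z
    using assms by (auto simp: ctrilinear_def)
  have T12: "cbilinear (\<lambda>u v. T u v z)" for z
    by (rule cbilinearI) (simp_all add: clinearD[OF T1] cbilinearD[OF T23])
  define L where "L = tensor_lift (\<lambda>u p. tensor_lift (T u) p)"
  have "T (u + u') = (\<lambda>v w. T u v w + T u' v w)" "T (c *\<^sub>C u) = (\<lambda>v w. c *\<^sub>C T u v w)" for u u' c
    by (simp_all add: fun_eq_iff clinearD[OF T1])
  then have bil: "cbilinear (\<lambda>u p. tensor_lift (T u) p)"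
    by (intro cbilinearI)
      (simp_all add: clinearD[OF clinear_tensor_lift[OF T23]]
        tensor_lift_fun_add tensor_lift_fun_scaleC)
  have L: "clinear L"
    unfolding L_def by (rule clinear_tensor_lift[OF bil])
  have assoc_inner: "cbilinear (\<lambda>(u::'h) (v::'h). u \<otimes> (v \<otimes> w))" for w :: 'h
    by (rule cbilinearI) (simp_all add: pure_tensor_bilinear)
  have assoc_outer: "cbilinear (\<lambda>(t :: ('h, 'h) tensor) (w :: 'h). tensor_lift (\<lambda>u v. u \<otimes> (v \<otimes> w)) t)"
    by (rule cbilinearI)
      (simp_all add: pure_tensor_bilinear clinearD[OF clinear_tensor_lift[OF assoc_inner]]
        tensor_lift_fun_add tensor_lift_fun_scaleC)
  have lin: "clinear (\<lambda>t. L (tensor_assoc t))"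
    unfolding tensor_assoc_def by (intro clinear_comp[OF L] clinear_tensor_lift assoc_outer)
  have "tensor_lift (\<lambda>x z. tensor_lift (\<lambda>u v. T u v z) (\<Delta> x)) (\<Delta> a) =
      L (tensor_assoc (tensor_map \<Delta> id (\<Delta> a)))"
    unfolding tensor_map_def tensor_lift_commute[OF lin]
    by (simp add: tensor_assoc_def tensor_lift_pure[OF assoc_outer] tensor_lift_commute[OF L])
      (simp add: L_def tensor_lift_pure[OF bil] tensor_lift_pure[OF T23])
  also have "\<dots> = L (tensor_map id \<Delta> (\<Delta> a))"
    by (simp add: coassoc)
  also have "\<dots> = tensor_lift (\<lambda>u z. tensor_lift (T u) (\<Delta> z)) (\<Delta> a)"
    unfolding tensor_map_def tensor_lift_commute[OF L]
    by (simp add: L_def tensor_lift_pure[OF bil])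
  finally show ?thesis .
qed

lemma counit_left_lift:
  assumes "clinear g"
  shows "tensor_lift (\<lambda>x y. \<epsilon> x *\<^sub>C g y) (\<Delta> a) = g a"
  using tensor_lift_commute[OF assms, of "\<lambda>x y. \<epsilon> x *\<^sub>C y" "\<Delta> a"]
  by (simp add: counit_left clinearD[OF assms])

lemma counit_right_lift:
  assumes "clinear g"
  shows "tensor_lift (\<lambda>x y. \<epsilon> y *\<^sub>C g x) (\<Delta> a) = g a"
  using tensor_lift_commute[OF assms, of "\<lambda>x y. \<epsilon> y *\<^sub>C x" "\<Delta> a"]
  by (simp add: counit_right clinearD[OF assms])

text \<open>The usual argument in a monoid: \<open>f = f * (g * h) = (f * g) * h = h\<close>.\<close>

lemma convolution_inverse_unique:
  fixes f g h :: "'h \<Rightarrow> 'b::complex_algebra"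
  assumes lin: "clinear f" "clinear g" "clinear h"
    and left: "\<And>a. tensor_lift (\<lambda>x y. f x * g y) (\<Delta> a) = \<epsilon> a *\<^sub>C 1"
    and right: "\<And>a. tensor_lift (\<lambda>x y. g x * h y) (\<Delta> a) = \<epsilon> a *\<^sub>C 1"
  shows "f a = h a"
proof -
  have "f a = tensor_lift (\<lambda>x z. f x * tensor_lift (\<lambda>y z. g y * h z) (\<Delta> z)) (\<Delta> a)"
    by (simp add: right counit_right_lift[OF lin(1)])
  also have "\<dots> = tensor_lift (\<lambda>x z. tensor_lift (\<lambda>y z. f x * (g y * h z)) (\<Delta> z)) (\<Delta> a)"
    by (simp add: mult_tensor_lift)
  also have "\<dots> = tensor_lift (\<lambda>x z. tensor_lift (\<lambda>u v. f u * g v * h z) (\<Delta> x)) (\<Delta> a)"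
    by (subst coassoc_lift[symmetric]) (simp_all add: ctrilinear_product lin mult.assoc)
  also have "\<dots> = tensor_lift (\<lambda>x z. tensor_lift (\<lambda>u v. f u * g v) (\<Delta> x) * h z) (\<Delta> a)"
    by (simp add: mult_tensor_lift)
  also have "\<dots> = h a"
    by (simp add: left counit_left_lift[OF lin(3)])
  finally show ?thesis .
qed

text \<open>
  In the convolution algebra of linear maps from \<open>H\<close> to \<open>H \<otimes> H\<close>, the map \<open>\<Delta> \<circ> S\<close> is a left
  inverse of \<open>\<Delta>\<close>, since \<open>\<Delta>\<close> is an algebra map.  The right-hand side \<open>h\<close> is a right inverse:
  \<open>a\<^sub>(\<^sub>1\<^sub>) S a\<^sub>(\<^sub>4\<^sub>) \<otimes> a\<^sub>(\<^sub>2\<^sub>) S a\<^sub>(\<^sub>3\<^sub>)\<close> collapses first in the inner pair and then in the outer one.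
\<close>

lemma coproduct_antipode: "\<Delta> (S a) = tensor_lift (\<lambda>x y. S y \<otimes> S x) (\<Delta> a)"
proof -
  define h where "h a = tensor_lift (\<lambda>x y. S y \<otimes> S x) (\<Delta> a)" for a
  note S = antipode_linear clinearD[OF antipode_linear]
  have bil: "cbilinear (\<lambda>x y. S y \<otimes> S x)"
    by (rule cbilinearI) (simp_all add: S pure_tensor_bilinear)
  have h: "clinear h"
    unfolding h_def by (rule clinear_tensor_lift_coproduct[OF bil])
  have fold_h: "(p \<otimes> q) * h y = tensor_lift (\<lambda>u v. (p * S v) \<otimes> (q * S u)) (\<Delta> y)" for p q y
    by (simp add: h_def mult_tensor_lift times_pure_tensor)
  \<comment> \<open>The inner pair: \<open>p S a\<^sub>(\<^sub>3\<^sub>) \<otimes> a\<^sub>(\<^sub>1\<^sub>) S a\<^sub>(\<^sub>2\<^sub>) = p S a \<otimes> 1\<close>, with \<open>z\<close> in place of \<open>a\<close>.\<close>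
  have inner: "tensor_lift (\<lambda>q y. (p \<otimes> q) * h y) (\<Delta> z) = (p * S z) \<otimes> 1" for p z
  proof -
    have tri: "ctrilinear (\<lambda>q u v. (p * S v) \<otimes> (q * S u))"
      unfolding ctrilinear_def
      by (intro conjI allI cbilinearI clinearI)
        (simp_all add: S pure_tensor_bilinear distrib_left distrib_right)
    have g: "clinear (\<lambda>v. (p * S v) \<otimes> (1 :: 'h))"
      by (rule clinearI) (simp_all add: S pure_tensor_bilinear distrib_left)
    have "tensor_lift (\<lambda>q y. (p \<otimes> q) * h y) (\<Delta> z) =
        tensor_lift (\<lambda>w v. tensor_lift (\<lambda>q u. (p * S v) \<otimes> (q * S u)) (\<Delta> w)) (\<Delta> z)"
      by (simp add: fold_h coassoc_lift[OF tri])
    also have "\<dots> = tensor_lift (\<lambda>w v. (p * S v) \<otimes> tensor_lift (\<lambda>q u. q * S u) (\<Delta> w)) (\<Delta> z)"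
      by (simp add: pure_tensor_lift)
    also have "\<dots> = (p * S z) \<otimes> 1"
      by (simp add: antipode_right pure_tensor_bilinear counit_left_lift[OF g])
    finally show ?thesis .
  qed
  have right: "tensor_lift (\<lambda>x y. \<Delta> x * h y) (\<Delta> a) = \<epsilon> a *\<^sub>C 1" for a
  proof -
    have tri: "ctrilinear (\<lambda>p q y. (p \<otimes> q) * h y)"
      unfolding ctrilinear_def
      by (intro conjI allI cbilinearI clinearI)
        (simp_all add: clinearD[OF h] pure_tensor_bilinear distrib_left distrib_right)
    have "tensor_lift (\<lambda>x y. \<Delta> x * h y) (\<Delta> a) =
        tensor_lift (\<lambda>x y. tensor_lift (\<otimes>) (\<Delta> x) * h y) (\<Delta> a)"
      by (simp add: tensor_lift_pure_tensor)
    also have "\<dots> = tensor_lift (\<lambda>x y. tensor_lift (\<lambda>p q. (p \<otimes> q) * h y) (\<Delta> x)) (\<Delta> a)"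
      by (simp add: mult_tensor_lift)
    also have "\<dots> = tensor_lift (\<lambda>p z. (p * S z) \<otimes> 1) (\<Delta> a)"
      by (simp add: coassoc_lift[OF tri] inner)
    also have "\<dots> = tensor_lift (\<lambda>p z. p * S z) (\<Delta> a) \<otimes> 1"
      by (simp add: pure_tensor_lift)
    finally show ?thesis
      by (simp add: antipode_right pure_tensor_bilinear one_tensor_def)
  qed
  have left: "tensor_lift (\<lambda>x y. \<Delta> (S x) * \<Delta> y) (\<Delta> a) = \<epsilon> a *\<^sub>C 1" for a
    using tensor_lift_commute[OF coproduct_linear, of "\<lambda>x y. S x * y" "\<Delta> a"]
    by (simp add: antipode_left coproduct_mult clinearD[OF coproduct_linear] coproduct_one
        one_tensor_def)
  have "\<Delta> (S a) = h a"
    by (rule convolution_inverse_unique[OF clinear_comp[OF coproduct_linear antipode_linear]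
          coproduct_linear h left right])
  then show ?thesis
    by (simp add: h_def)
qed

text \<open>Both sides are \<open>\<epsilon> (S a\<^sub>(\<^sub>1\<^sub>) a\<^sub>(\<^sub>2\<^sub>))\<close>: evaluate it by multiplicativity of \<open>\<epsilon>\<close> and by the antipode axiom.\<close>

lemma counit_antipode: "\<epsilon> (S a) = \<epsilon> a"
proof -
  have "\<epsilon> (S a) = tensor_lift (\<lambda>x y. \<epsilon> y *\<^sub>C \<epsilon> (S x)) (\<Delta> a)"
    by (rule counit_right_lift[symmetric, OF clinear_comp[OF counit_linear antipode_linear]])
  also have "\<dots> = \<epsilon> (tensor_lift (\<lambda>x y. S x * y) (\<Delta> a))"
    by (simp add: tensor_lift_commute[OF counit_linear] counit_mult mult.commute)
  also have "\<dots> = \<epsilon> a"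
    by (simp add: antipode_left clinearD[OF counit_linear] counit_one)
  finally show ?thesis .
qed

end


section \<open>The star operation of a Hopf star-algebra\<close>

lemma Bar_add: "Bar (x + y) = Bar x + Bar y"
  and Bar_scaleC: "Bar (c *\<^sub>C x) = cnj c *\<^sub>C Bar x"
  by (simp_all add: plus_conjugate_def scaleC_conjugate_def)

lemma clinear_unbar_antilinear:
  "antilinear g \<Longrightarrow> clinear (\<lambda>x. g (unbar x))"
  by (rule clinearI) (simp_all add: antilinear_def plus_conjugate_def scaleC_conjugate_def)

lemma clinear_conj_map: "clinear f \<Longrightarrow> clinear (conj_map f)"
  by (rule clinearI)
    (simp_all add: plus_conjugate_def scaleC_conjugate_def conjugate.map_sel clinearD conjugate.expand)

context hopf_star_algebra
begin

lemma star_add: "star (x + y) = star x + star y"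
  and star_scaleC: "star (c *\<^sub>C x) = cnj c *\<^sub>C star x"
  using star_antilinear by (auto simp: antilinear_def)

lemma cbilinear_Bar_star:
  "cbilinear B \<Longrightarrow> cbilinear (\<lambda>x y. Bar (B (star x) (star y)))"
  by (rule cbilinearI)
    (simp_all add: star_add star_scaleC cbilinearD Bar_add Bar_scaleC)

lemma tensor_lift_coproduct_star:
  assumes "cbilinear B"
  shows "Bar (tensor_lift B (\<Delta> (star a))) = tensor_lift (\<lambda>x y. Bar (B (star x) (star y))) (\<Delta> a)"
proof -
  have "Bar (tensor_lift B (\<Delta> (star a))) =
      conj_map (tensor_lift B) (tensor_lift (\<lambda>x y. Bar (star x \<otimes> star y)) (\<Delta> a))"
    by (simp add: coproduct_star conjugate.expand conjugate.map_sel)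
  also have "\<dots> = tensor_lift (\<lambda>x y. Bar (B (star x) (star y))) (\<Delta> a)"
    by (simp add: tensor_lift_commute[OF clinear_conj_map[OF clinear_tensor_lift[OF assms]]] assms)
  finally show ?thesis .
qed

text \<open>
  The star preserves the order of the two legs of the coproduct and the antipode reverses it, so
  \<open>a \<mapsto> S(a)\<^sup>*\<close> reverses it.  The action on a conjugate module is defined through this map.
\<close>

lemma tensor_lift_coproduct_star_antipode:
  assumes "cbilinear B"
  shows "Bar (tensor_lift B (\<Delta> (star (S a)))) =
    tensor_lift (\<lambda>x y. Bar (B (star (S y)) (star (S x)))) (\<Delta> a)"
  unfolding tensor_lift_coproduct_star[OF assms] coproduct_antipode
  by (simp add: tensor_lift_commute[OF clinear_tensor_lift[OF cbilinear_Bar_star[OF assms]]]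
      tensor_lift_pure[OF cbilinear_Bar_star[OF assms]])

text \<open>
  The linear map \<open>a \<mapsto> cnj (\<epsilon> (a\<^sup>*))\<close> is a left counit, as one sees by applying the star to the
  counit axiom for \<open>a\<^sup>*\<close>.  A left counit agrees with a right counit.
\<close>

lemma counit_star: "\<epsilon> (star a) = cnj (\<epsilon> a)"
proof -
  have e: "clinear (\<lambda>x. cnj (\<epsilon> (star x)))"
    by (rule clinearI) (simp_all add: star_add star_scaleC clinearD[OF counit_linear])
  have g: "clinear (\<lambda>x. star (unbar x))"
    by (rule clinear_unbar_antilinear[OF star_antilinear])
  have "a = star (unbar (Bar (tensor_lift (\<lambda>x y. \<epsilon> x *\<^sub>C y) (\<Delta> (star a)))))"
    by (simp add: counit_left star_star)
  also have "\<dots> = tensor_lift (\<lambda>x y. cnj (\<epsilon> (star x)) *\<^sub>C y) (\<Delta> a)"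
    by (simp only: tensor_lift_coproduct_star[OF cbilinear_scale_left[OF counit_linear clinear_id]]
        tensor_lift_commute[OF g] conjugate.sel star_scaleC star_star)
  finally have "\<epsilon> a = \<epsilon> (tensor_lift (\<lambda>x y. cnj (\<epsilon> (star x)) *\<^sub>C y) (\<Delta> a))"
    by (rule arg_cong)
  also have "\<dots> = tensor_lift (\<lambda>x y. \<epsilon> y *\<^sub>C cnj (\<epsilon> (star x))) (\<Delta> a)"
    by (simp add: tensor_lift_commute[OF counit_linear] clinearD[OF counit_linear] mult.commute)
  also have "\<dots> = cnj (\<epsilon> (star a))"
    by (rule counit_right_lift[OF e])
  finally show ?thesis
    by simp
qed

end


section \<open>Universal property of the tensor algebra\<close>

lemma Bar_mult: "Bar (x * y) = Bar y * Bar x"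
  and Bar_one: "Bar 1 = 1"
  by (simp_all add: times_conjugate_def one_conjugate_def)

lemma unbar_simps:
  "unbar (x + y) = unbar x + unbar y" "unbar (c *\<^sub>C x) = cnj c *\<^sub>C unbar x"
  "unbar (a * b) = unbar b * unbar a" "unbar 1 = 1"
  by (simp_all add: plus_conjugate_def scaleC_conjugate_def times_conjugate_def one_conjugate_def)

lemma algebra_homI:
  assumes "clinear F" "\<And>x y. F (x * y) = F x * F y" "F 1 = 1"
  shows "algebra_hom F"
  using assms by (simp add: algebra_hom_def)

lemma algebra_homD:
  assumes "algebra_hom F"
  shows "clinear F" "F (x * y) = F x * F y" "F 1 = 1"
  using assms by (simp_all add: algebra_hom_def)

lemma algebra_hom_comp: "algebra_hom F \<Longrightarrow> algebra_hom G \<Longrightarrow> algebra_hom (\<lambda>x. F (G x))"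
  by (simp add: algebra_hom_def clinear_comp)

lemma algebra_hom_conj_map: "algebra_hom F \<Longrightarrow> algebra_hom (conj_map F)"
  by (rule algebra_homI)
    (simp_all add: algebra_homD clinear_conj_map times_conjugate_def one_conjugate_def
      conjugate.map_sel)

text \<open>
  A homomorphism on a conjugate algebra is an antilinear antimultiplicative map on the algebra
  itself; conjugating its values makes it a homomorphism again.  The next two lemmas pass between
  homomorphisms out of \<open>conj A\<close> and homomorphisms into \<open>conj B\<close>, so that the universal property of
  \<open>T(V)\<close> also governs its conjugate.
\<close>

lemma algebra_hom_Bar:
  assumes "algebra_hom F"
  shows "algebra_hom (\<lambda>x. Bar (F (Bar x)))"
  by (intro algebra_homI clinearI)
    (simp_all add: Bar_add Bar_scaleC Bar_mult Bar_one algebra_homD(2,3)[OF assms]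
      clinearD[OF algebra_homD(1)[OF assms]])

lemma algebra_hom_unbar:
  assumes "algebra_hom F"
  shows "algebra_hom (\<lambda>x. unbar (F (unbar x)))"
  by (intro algebra_homI clinearI)
    (simp_all add: unbar_simps algebra_homD(2,3)[OF assms] clinearD[OF algebra_homD(1)[OF assms]])

lemma clinear_tensor_incl: "clinear tensor_incl"
  using multilinearD[OF multilinear_pure_word, where us = "[]" and ws = "[]"]
  by (intro clinearI) (simp_all add: tensor_incl_def)

lemma pure_word_Cons: "pure_word (v # vs) = tensor_incl v * pure_word vs"
  by (simp add: tensor_incl_def times_pure_word)

lemma pure_word_snoc: "pure_word (vs @ [v]) = pure_word vs * tensor_incl v"
  by (simp add: tensor_incl_def times_pure_word)

lemma pure_word_Nil: "pure_word [] = 1"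
  by (simp add: one_tensor_algebra_def)

lemma algebra_hom_pure_word:
  assumes "algebra_hom F"
  shows "F (pure_word vs) = prod_list (map (\<lambda>v. F (tensor_incl v)) vs)"
  by (induction vs) (simp_all add: pure_word_Nil pure_word_Cons algebra_homD[OF assms])

lemma tensor_algebra_hom_eqI:
  assumes "algebra_hom F" "algebra_hom G" "\<And>v. F (tensor_incl v) = G (tensor_incl v)"
  shows "F x = G x"
  by (rule word_eqI)
    (simp_all add: assms(3) algebra_homD(1)[OF assms(1)] algebra_homD(1)[OF assms(2)]
      algebra_hom_pure_word[OF assms(1)] algebra_hom_pure_word[OF assms(2)])

lemma conj_tensor_algebra_hom_eqI:
  assumes "algebra_hom F" "algebra_hom G" "\<And>v. F (Bar (tensor_incl v)) = G (Bar (tensor_incl v))"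
  shows "F = G"
proof
  fix x :: "'a tensor_algebra conjugate"
  have "Bar (F (Bar (unbar x))) = Bar (G (Bar (unbar x)))"
    by (rule tensor_algebra_hom_eqI[OF algebra_hom_Bar[OF assms(1)] algebra_hom_Bar[OF assms(2)]])
      (simp add: assms(3))
  then show "F x = G x"
    by simp
qed

lemma word_bilinear_eqI:
  assumes "cbilinear B" "cbilinear C"
    and "\<And>vs ws. B (pure_word vs) (pure_word ws) = C (pure_word vs) (pure_word ws)"
  shows "B s t = C s t"
proof (rule word_eqI[where f = "\<lambda>s. B s t" and g = "\<lambda>s. C s t"])
  show "B (pure_word vs) t = C (pure_word vs) t" for vs
    by (rule word_eqI) (use assms in \<open>auto simp: cbilinear_def\<close>)
qed (use assms in \<open>auto simp: cbilinear_def\<close>)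

definition tensor_hom :: "('v::complex_vector \<Rightarrow> 'a::complex_algebra) \<Rightarrow> 'v tensor_algebra \<Rightarrow> 'a"
  where "tensor_hom f = word_lift (\<lambda>vs. prod_list (map f vs))"

lemma multilinear_prod_list:
  fixes f :: "'v::complex_vector \<Rightarrow> 'a::complex_algebra"
  assumes "clinear f"
  shows "multilinear (\<lambda>vs. prod_list (map f vs))"
  by (rule multilinearI) (simp_all add: clinearD[OF assms] distrib_left distrib_right)

lemma tensor_hom_pure_word: "clinear f \<Longrightarrow> tensor_hom f (pure_word vs) = prod_list (map f vs)"
  by (simp add: tensor_hom_def multilinear_prod_list)

lemma tensor_hom_incl: "clinear f \<Longrightarrow> tensor_hom f (tensor_incl v) = f v"
  by (simp add: tensor_incl_def tensor_hom_pure_word)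

lemma algebra_hom_tensor_hom:
  assumes "clinear f"
  shows "algebra_hom (tensor_hom f)"
proof (rule algebra_homI)
  show lin: "clinear (tensor_hom f)"
    unfolding tensor_hom_def by (rule clinear_word_lift[OF multilinear_prod_list[OF assms]])
  show "tensor_hom f (x * y) = tensor_hom f x * tensor_hom f y" for x y
    by (rule word_bilinear_eqI[OF clinear_cbilinear[OF lin cbilinear_times]
          cbilinear_comp[OF cbilinear_times lin lin]])
      (simp add: times_pure_word tensor_hom_pure_word assms)
  show "tensor_hom f 1 = 1"
    by (simp add: one_tensor_algebra_def tensor_hom_pure_word assms)
qed


section \<open>The tensor algebra as a module algebra\<close>

lemma hmoduleD:
  assumes "hmodule act"
  shows "cbilinear act" "act 1 v = v" "act (a * b) v = act a (act b v)"
  using assms unfolding hmodule_def by blast+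

locale hopf_module = hopf_algebra \<Delta> \<epsilon> S
  for \<Delta> :: "'h::complex_algebra \<Rightarrow> ('h, 'h) tensor" and \<epsilon> S +
  fixes act :: "'h \<Rightarrow> 'v::complex_vector \<Rightarrow> 'v"
  assumes hmodule_act: "hmodule act"
begin

abbreviation wact where "wact \<equiv> word_act \<Delta> \<epsilon> act"
abbreviation tact where "tact \<equiv> tensor_act \<Delta> \<epsilon> act"

lemmas act_simps = cbilinearD[OF hmoduleD(1)[OF hmodule_act]] hmoduleD(2,3)[OF hmodule_act]

lemma clinear_incl_act: "clinear (\<lambda>a. tensor_incl (act a v))"
  by (rule clinear_comp[OF clinear_tensor_incl]) (use hmoduleD(1)[OF hmodule_act] in \<open>simp add: cbilinear_def\<close>)

lemma clinear_word_act: "clinear (\<lambda>a. wact a vs)"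
proof (induction vs)
  case Nil
  show ?case
    by (rule clinearI) (simp_all add: clinearD[OF counit_linear] scaleC_add_left)
next
  case (Cons v vs)
  show ?case
    using clinear_tensor_lift_coproduct[OF cbilinear_comp[OF cbilinear_times clinear_incl_act Cons]]
    by simp
qed

lemma cbilinear_word_act_Cons: "cbilinear (\<lambda>b c. tensor_incl (act b v) * wact c vs)"
  by (rule cbilinear_comp[OF cbilinear_times clinear_incl_act clinear_word_act])

lemma multilinear_word_act: "multilinear (wact a)"
proof (rule multilinearI)
  note linear_simps = act_simps clinearD[OF clinear_tensor_incl] distrib_left distrib_right
    tensor_lift_fun_add tensor_lift_fun_scaleC
  show "wact a (us @ (v + v') # ws) = wact a (us @ v # ws) + wact a (us @ v' # ws)" for us v v' ws
    by (induction us arbitrary: a) (simp_all add: linear_simps)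
  show "wact a (us @ (c *\<^sub>C v) # ws) = c *\<^sub>C wact a (us @ v # ws)" for c us v ws
    by (induction us arbitrary: a) (simp_all add: linear_simps)
qed

lemma tensor_act_pure_word: "tact a (pure_word vs) = wact a vs"
  by (simp add: tensor_act_def multilinear_word_act)

lemma tensor_act_one: "tact a 1 = \<epsilon> a *\<^sub>C 1"
  using tensor_act_pure_word[of a "[]"] by (simp add: pure_word_Nil)

lemma tensor_act_incl: "tact a (tensor_incl v) = tensor_incl (act a v)"
  by (simp add: tensor_incl_def[of v] tensor_act_pure_word counit_right_lift clinear_incl_act)

lemma cbilinear_tensor_act: "cbilinear tact"
proof -
  note lin = clinearD[OF clinear_word_act]
  have "wact (a + b) = (\<lambda>vs. wact a vs + wact b vs)" "wact (c *\<^sub>C a) = (\<lambda>vs. c *\<^sub>C wact a vs)" for a b c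
    by (simp_all add: fun_eq_iff lin)
  then show ?thesis
    by (intro cbilinearI)
      (simp_all add: tensor_act_def word_lift_fun_add word_lift_fun_scaleC
        clinearD[OF clinear_word_lift[OF multilinear_word_act]])
qed

lemma clinear_tensor_act: "clinear (tact a)"
  using cbilinear_tensor_act by (auto simp: cbilinear_def)

text \<open>
  The recursive definition splits off one letter at a time; coassociativity allows a word to be
  cut anywhere.  This is multiplicativity of the action on words.
\<close>

lemma word_act_append:
  "wact a (us @ vs) = tensor_lift (\<lambda>b c. wact b us * wact c vs) (\<Delta> a)"
proof (induction us arbitrary: a)
  case Nil
  show ?case
    by (simp add: counit_left_lift[OF clinear_word_act])
next
  case (Cons u us)
  have "wact a ((u # us) @ vs) =
      tensor_lift (\<lambda>b z. tensor_lift (\<lambda>c d. tensor_incl (act b u) * (wact c us * wact d vs)) (\<Delta> z)) (\<Delta> a)"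
    by (simp add: Cons mult_tensor_lift)
  also have "\<dots> = tensor_lift (\<lambda>x d. tensor_lift (\<lambda>b c. tensor_incl (act b u) * (wact c us * wact d vs)) (\<Delta> x)) (\<Delta> a)"
    by (rule coassoc_lift[symmetric])
      (rule ctrilinear_product[OF clinear_incl_act clinear_word_act clinear_word_act])
  finally show ?case
    by (simp add: mult_tensor_lift mult.assoc)
qed

lemma tensor_act_mult: "tact a (x * y) = tensor_lift (\<lambda>b c. tact b x * tact c y) (\<Delta> a)"
proof (rule word_bilinear_eqI[where B = "\<lambda>x y. tact a (x * y)"])
  show "cbilinear (\<lambda>x y. tact a (x * y))"
    by (rule clinear_cbilinear[OF clinear_tensor_act cbilinear_times])
  show "cbilinear (\<lambda>x y. tensor_lift (\<lambda>b c. tact b x * tact c y) (\<Delta> a))"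
    by (rule cbilinearI)
      (simp_all add: clinearD[OF clinear_tensor_act] distrib_left distrib_right
        tensor_lift_fun_add tensor_lift_fun_scaleC)
qed (simp add: times_pure_word tensor_act_pure_word word_act_append)

text \<open>
  In the inductive step, \<open>\<Delta>(a b) = \<Delta> a \<Delta> b\<close> turns the right-hand side into a double sum over
  \<open>\<Delta> a\<close> and \<open>\<Delta> b\<close>, and multiplicativity of the action of \<open>a\<close> turns the left-hand side into
  the same sum in the other order.
\<close>

lemma tensor_act_word_act: "tact a (wact b vs) = wact (a * b) vs"
proof (induction vs arbitrary: a b)
  case Nil
  show ?case
    by (simp add: tensor_act_one clinearD[OF clinear_tensor_act] counit_mult mult.commute)
next
  case (Cons v vs)
  have "tact a (wact b (v # vs)) =
      tensor_lift (\<lambda>u w. tensor_lift (\<lambda>x y. tensor_incl (act (x * u) v) * wact (y * w) vs) (\<Delta> a)) (\<Delta> b)"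
    by (simp add: tensor_lift_commute[OF clinear_tensor_act] tensor_act_mult tensor_act_incl
        act_simps Cons)
  also have "\<dots> = wact (a * b) (v # vs)"
    by (simp add: tensor_lift_coproduct_mult[OF cbilinear_word_act_Cons]) (rule tensor_lift_swap)
  finally show ?case .
qed

lemma word_act_one: "wact 1 vs = pure_word vs"
  by (induction vs)
    (simp_all add: counit_one coproduct_one pure_word_Nil pure_word_Cons act_simps
      tensor_lift_pure[OF cbilinear_word_act_Cons])

lemma hmodule_tensor_act: "hmodule tact"
  unfolding hmodule_def
proof (intro conjI allI)
  show "tact 1 x = x" for x
    by (rule word_eqI[where g = "\<lambda>x. x"])
      (simp_all add: clinear_tensor_act clinear_id tensor_act_pure_word word_act_one)
  show "tact (a * b) x = tact a (tact b x)" for a b x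
    by (rule word_eqI[where g = "\<lambda>x. tact a (tact b x)"])
      (simp_all add: clinear_tensor_act clinear_comp tensor_act_pure_word tensor_act_word_act)
qed (rule cbilinear_tensor_act)

lemma module_algebra_tensor_act: "module_algebra \<Delta> \<epsilon> tact"
  unfolding module_algebra_def
  by (simp add: hmodule_tensor_act tensor_act_mult tensor_act_one)

lemma module_map_tensor_hom:
  assumes "module_algebra \<Delta> \<epsilon> actA" "module_map act actA f"
  shows "module_map tact actA (tensor_hom f)"
proof -
  have f: "clinear f" "\<And>a v. f (act a v) = actA a (f v)"
    using assms(2) by (auto simp: module_map_def)
  have A: "cbilinear actA" "\<And>a. actA a 1 = \<epsilon> a *\<^sub>C 1"
    "\<And>a x y. actA a (x * y) = tensor_lift (\<lambda>b c. actA b x * actA c y) (\<Delta> a)"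
    using assms(1) by (auto simp: module_algebra_def hmodule_def)
  note hom = algebra_homD[OF algebra_hom_tensor_hom[OF f(1)]]
  have word: "tensor_hom f (wact a vs) = actA a (tensor_hom f (pure_word vs))" for a vs
    by (induction vs arbitrary: a)
      (simp_all add: pure_word_Nil pure_word_Cons tensor_lift_commute[OF hom(1)] hom(2,3)
        clinearD[OF hom(1)] tensor_hom_incl f A(2,3))
  have "tensor_hom f (tact a x) = actA a (tensor_hom f x)" for a x
  proof (rule word_eqI[where f = "\<lambda>x. tensor_hom f (tact a x)"])
    show "clinear (\<lambda>x. actA a (tensor_hom f x))"
      using A(1) by (intro clinear_comp[OF _ hom(1)]) (simp add: cbilinear_def)
  qed (simp_all add: clinear_comp[OF hom(1) clinear_tensor_act] tensor_act_pure_word word)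
  then show ?thesis
    by (simp add: module_map_def hom(1))
qed

end


section \<open>The star-structure on the tensor algebra\<close>

text \<open>
  Since the product of a conjugate algebra is reversed, the star of \<open>T(V)\<close> comes from the
  homomorphism from \<open>T(V)\<close> to its own conjugate that extends \<open>v \<mapsto> Bar (s (Bar v))\<close>.  So it
  inherits additivity and multiplicativity from that homomorphism.
\<close>

lemma tensor_star_eq_tensor_hom:
  fixes s :: "'v::complex_vector conjugate \<Rightarrow> 'v"
  shows "tensor_star s x = unbar (tensor_hom (\<lambda>v. Bar (tensor_incl (s (Bar v)))) (unbar x))"
proof -
  have "Bar (pure_word (rev (map (\<lambda>v. s (Bar v)) vs))) =
      prod_list (map (\<lambda>v. Bar (tensor_incl (s (Bar v)))) vs)" for vs
    by (induction vs) (simp_all add: pure_word_Nil pure_word_snoc Bar_one Bar_mult)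
  then show ?thesis
    by (simp add: tensor_star_def tensor_hom_def)
qed

lemma clinear_Bar_incl:
  "clinear s \<Longrightarrow> clinear (\<lambda>v. Bar (tensor_incl (s (Bar v))))"
  by (rule clinearI) (simp_all add: Bar_add Bar_scaleC clinearD clinear_tensor_incl)

lemma algebra_hom_tensor_star: "clinear s \<Longrightarrow> algebra_hom (tensor_star s)"
  unfolding tensor_star_eq_tensor_hom[abs_def]
  by (intro algebra_hom_unbar algebra_hom_tensor_hom clinear_Bar_incl)

lemma tensor_star_incl: "clinear s \<Longrightarrow> tensor_star s (Bar (tensor_incl v)) = tensor_incl (s (Bar v))"
  by (simp add: tensor_star_eq_tensor_hom tensor_hom_incl clinear_Bar_incl)

lemma tensor_star_pure_word:
  fixes s :: "'v::complex_vector conjugate \<Rightarrow> 'v"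
  assumes "clinear s"
  shows "tensor_star s (Bar (pure_word vs)) = pure_word (rev (map (\<lambda>v. s (Bar v)) vs))"
  by (induction vs)
    (simp_all add: pure_word_Nil pure_word_Cons pure_word_snoc Bar_one Bar_mult tensor_star_incl
      assms algebra_homD[OF algebra_hom_tensor_star[OF assms]])

text \<open>The square of the star is an algebra endomorphism of \<open>T(V)\<close> that fixes the generators.\<close>

lemma tensor_star_involutive:
  assumes s: "clinear s" and inv: "s \<circ> conj_map s = conj_sigma"
  shows "tensor_star s \<circ> conj_map (tensor_star s) = conj_sigma"
proof -
  have inv': "s (Bar (s (Bar v))) = v" for v
    using fun_cong[OF inv, of "Bar (Bar v)"] by (simp add: conj_sigma_def)
  note hom = algebra_hom_tensor_star[OF s]
  have "tensor_star s (Bar (tensor_star s (Bar x))) = x" for x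
    by (rule tensor_algebra_hom_eqI[OF algebra_hom_comp[OF hom algebra_hom_Bar[OF hom]]])
      (simp_all add: algebra_hom_def clinear_id tensor_star_incl s inv')
  then have "(tensor_star s \<circ> conj_map (tensor_star s)) (Bar (Bar x)) = conj_sigma (Bar (Bar x))" for x
    by (simp add: conj_sigma_def)
  then show ?thesis
    by (intro ext) (metis conjugate.collapse)
qed

lemma star_map_Bar:
  assumes "star_map s t T"
  shows "t (Bar (T v)) = T (s (Bar v))"
proof -
  have "(T \<circ> s) (Bar v) = (t \<circ> conj_map T) (Bar v)"
    using assms by (simp add: star_map_def)
  then show ?thesis
    by simp
qed

locale hopf_star_module = hopf_star_algebra \<Delta> \<epsilon> S star + hopf_module \<Delta> \<epsilon> S act
  for \<Delta> :: "'h::complex_algebra \<Rightarrow> ('h, 'h) tensor" and \<epsilon> S star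
    and act :: "'h \<Rightarrow> 'v::complex_vector \<Rightarrow> 'v" +
  fixes s :: "'v conjugate \<Rightarrow> 'v"
  assumes star_structure_act: "star_structure S star act s"
begin

lemma star_linear: "clinear s"
  and star_involutive: "s \<circ> conj_map s = conj_sigma"
  using star_structure_act by (auto simp: star_structure_def module_map_def)

lemma star_act: "s (Bar (act (star (S a)) v)) = act a (s (Bar v))"
proof -
  have "s (conj_act S star act a (Bar v)) = act a (s (Bar v))"
    using star_structure_act unfolding star_structure_def module_map_def by blast
  then show ?thesis
    by (simp add: conj_act_def)
qed

lemmas tensor_star_hom = algebra_homD[OF algebra_hom_tensor_star[OF star_linear]]

text \<open>
  For a word \<open>v w\<close>, with \<open>v\<close> a letter, two reversals cancel: that of the product by the star and
  that of the coproduct by \<open>a \<mapsto> S(a)\<^sup>*\<close>.  What remains is \<open>(a\<^sub>(\<^sub>1\<^sub>) w\<^sup>*) (a\<^sub>(\<^sub>2\<^sub>) v\<^sup>*)\<close>, which is the action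
  of \<open>a\<close> on \<open>w\<^sup>* v\<^sup>*\<close>.
\<close>

lemma tensor_star_word_act:
  "tensor_star s (Bar (wact (star (S a)) vs)) = tact a (tensor_star s (Bar (pure_word vs)))"
proof (induction vs arbitrary: a)
  case Nil
  show ?case
    by (simp add: tensor_act_one counit_star counit_antipode Bar_scaleC Bar_one pure_word_Nil
        tensor_star_hom(3) clinearD[OF tensor_star_hom(1)])
next
  case (Cons v vs)
  have "tensor_star s (Bar (wact (star (S a)) (v # vs))) =
      tensor_lift (\<lambda>x y. tact x (tensor_star s (Bar (pure_word vs))) * tact y (tensor_incl (s (Bar v)))) (\<Delta> a)"
    by (simp add: tensor_lift_coproduct_star_antipode[OF cbilinear_word_act_Cons]
        tensor_lift_commute[OF tensor_star_hom(1)] Bar_mult tensor_star_hom(2) tensor_star_incl star_linear star_act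
        Cons tensor_act_incl)
  also have "\<dots> = tact a (tensor_star s (Bar (pure_word (v # vs))))"
    by (simp add: pure_word_Cons Bar_mult tensor_star_hom(2) tensor_star_incl star_linear tensor_act_mult)
  finally show ?case .
qed

lemma star_structure_tensor_star: "star_structure S star tact (tensor_star s)"
  unfolding star_structure_def module_map_def
proof (intro conjI allI)
  show lin: "clinear (tensor_star s)"
    by (rule tensor_star_hom(1))
  show "tensor_star s \<circ> conj_map (tensor_star s) = conj_sigma"
    by (rule tensor_star_involutive[OF star_linear star_involutive])
  \<comment> \<open>Both sides are antilinear in the element of \<open>T(V)\<close>.  An outer \<open>Bar\<close> makes them linear, so
    that comparison on words applies.\<close>
  have *: "clinear (\<lambda>x. Bar (tensor_star s (Bar x)))"
    by (rule clinearI) (simp_all add: Bar_add Bar_scaleC clinearD[OF lin])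
  have **: "clinear (\<lambda>x. Bar (tact a (tensor_star s (Bar x))))" for a
    by (rule clinearI) (simp_all add: Bar_add Bar_scaleC clinearD[OF lin] clinearD[OF clinear_tensor_act])
  fix a x
  have "Bar (tensor_star s (Bar (tact (star (S a)) (unbar x)))) =
      Bar (tact a (tensor_star s (Bar (unbar x))))"
    by (rule word_eqI[OF clinear_comp[OF * clinear_tensor_act] **])
      (simp add: tensor_act_pure_word tensor_star_word_act)
  then show "tensor_star s (conj_act S star tact a x) = tact a (tensor_star s x)"
    by (simp add: conj_act_def)
qed

lemma star_algebra_tensor_star: "star_algebra \<Delta> \<epsilon> S star tact (tensor_star s)"
  by (simp add: star_algebra_def module_algebra_tensor_act star_structure_tensor_star
      algebra_hom_tensor_star star_linear)

lemma star_module_map_tensor_incl: "star_module_map act s tact (tensor_star s) tensor_incl"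
proof -
  have "tensor_incl (s x) = tensor_star s (conj_map tensor_incl x)" for x
    using tensor_star_incl[OF star_linear, of "unbar x"] by (cases x) simp
  then show ?thesis
    by (simp add: star_module_map_def star_map_def module_map_def clinear_tensor_incl
        tensor_act_incl fun_eq_iff)
qed

lemma tensor_star_unique:
  assumes "star_algebra \<Delta> \<epsilon> S star tact t" "star_module_map act s tact t tensor_incl"
  shows "t = tensor_star s"
proof (rule conj_tensor_algebra_hom_eqI)
  show "algebra_hom t" "algebra_hom (tensor_star s)"
    using assms(1) by (simp_all add: star_algebra_def algebra_hom_tensor_star star_linear)
  show "t (Bar (tensor_incl v)) = tensor_star s (Bar (tensor_incl v))" for v
    using assms(2) by (simp add: star_module_map_def star_map_Bar tensor_star_incl star_linear)
qed

end

text \<open>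
  \<open>F \<circ> *\<close> and \<open>t \<circ> conj F\<close> are algebra homomorphisms out of the conjugate of \<open>T(V)\<close>, so it is
  enough to compare them on generators.
\<close>

lemma star_map_algebra_hom:
  assumes s: "clinear s" and F: "algebra_hom F" and t: "algebra_hom t"
    and gen: "star_map s t (F \<circ> tensor_incl)"
  shows "star_map (tensor_star s) t F"
proof -
  have "F (tensor_incl (s (Bar v))) = t (Bar (F (tensor_incl v)))" for v
    using star_map_Bar[OF gen, of v] by simp
  then have "(\<lambda>x. F (tensor_star s x)) = (\<lambda>x. t (conj_map F x))"
    by (intro conj_tensor_algebra_hom_eqI algebra_hom_comp[OF F algebra_hom_tensor_star[OF s]]
        algebra_hom_comp[OF t algebra_hom_conj_map[OF F]])
      (simp add: tensor_star_incl s)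
  then show ?thesis
    by (simp add: star_map_def algebra_homD(1)[OF F] comp_def)
qed


section \<open>Extension of star-module maps to the tensor algebra\<close>

theorem proposition7p8:
  fixes \<Delta> :: "'h::complex_algebra \<Rightarrow> ('h, 'h) tensor"
    and \<epsilon> :: "'h \<Rightarrow> complex"
    and S star :: "'h \<Rightarrow> 'h"
    and actV :: "'h \<Rightarrow> 'v::complex_vector \<Rightarrow> 'v"
    and starV :: "'v conjugate \<Rightarrow> 'v"
    and actA :: "'h \<Rightarrow> 'a::complex_algebra \<Rightarrow> 'a"
    and starA :: "'a conjugate \<Rightarrow> 'a"
    and f :: "'v \<Rightarrow> 'a"
  defines "actT \<equiv> tensor_act \<Delta> \<epsilon> actV"
    and "starT \<equiv> tensor_star starV"
  assumes "hopf_star_algebra \<Delta> \<epsilon> S star"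
    and "star_module S star actV starV"
    and "star_algebra \<Delta> \<epsilon> S star actA starA"
    and "star_module_map actV starV actA starA f"
  shows
    "star_algebra \<Delta> \<epsilon> S star actT starT \<and>
     star_module_map actV starV actT starT tensor_incl \<and>
     (\<forall>s. star_algebra \<Delta> \<epsilon> S star actT s \<and> star_module_map actV starV actT s tensor_incl \<longrightarrow> s = starT) \<and>
     (\<forall>vs. starT (Bar (pure_word vs)) = pure_word (rev (map (\<lambda>v. starV (Bar v)) vs))) \<and>
     (\<exists>!F. module_algebra_hom actT actA F \<and> F \<circ> tensor_incl = f) \<and>
     (\<forall>F. module_algebra_hom actT actA F \<and> F \<circ> tensor_incl = f \<longrightarrow>
        star_algebra_hom actT starT actA starA F)"
proof -
  interpret hopf_star_algebra \<Delta> \<epsilon> S star by fact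
  interpret hopf_star_module \<Delta> \<epsilon> S star actV starV
    using assms(4) by unfold_locales (auto simp: star_module_def)
  have f: "clinear f" "module_map actV actA f" "star_map starV starA f"
    and A: "module_algebra \<Delta> \<epsilon> actA" "algebra_hom starA"
    using assms(5,6) by (auto simp: star_module_map_def star_map_def star_algebra_def)
  have "\<exists>!F. module_algebra_hom actT actA F \<and> F \<circ> tensor_incl = f"
  proof (rule ex1I[of _ "tensor_hom f"])
    show "module_algebra_hom actT actA (tensor_hom f) \<and> tensor_hom f \<circ> tensor_incl = f"
      using module_map_tensor_hom[OF A(1) f(2)]
      by (auto simp: module_algebra_hom_def actT_def algebra_hom_tensor_hom tensor_hom_incl f(1))
    show "F = tensor_hom f" if "module_algebra_hom actT actA F \<and> F \<circ> tensor_incl = f" for F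
    proof
      show "F x = tensor_hom f x" for x
        by (rule tensor_algebra_hom_eqI)
          (use that in \<open>auto simp: module_algebra_hom_def algebra_hom_tensor_hom tensor_hom_incl f(1)\<close>)
    qed
  qed
  moreover have "star_algebra_hom actT starT actA starA F"
    if F: "module_algebra_hom actT actA F" "F \<circ> tensor_incl = f" for F
    using F star_map_algebra_hom[OF star_linear _ A(2), of F] f(3)
    by (auto simp: module_algebra_hom_def star_algebra_hom_def star_module_map_def starT_def)
  ultimately show ?thesis
    unfolding actT_def starT_def
    using star_algebra_tensor_star star_module_map_tensor_incl tensor_star_unique
      tensor_star_pure_word[OF star_linear]
    by blast
qed

end
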